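(* Let $$ L^{ZVG}(z)=\sum_{\alpha=1}^3\bigl(S_\alpha\varphi_\alpha(z)+\tilde\nu_\alpha\varphi_\alpha(z-\omega_\alpha)\bigr)\sigma_\alpha=\sum_{\alpha=1}^3\Bigl(S_\alpha\varphi_\alpha(z)+\frac{\nu'_\alpha}{\varphi_\alpha(z)}\Bigr)\sigma_\alpha . $$ There exists the matrix $$ M^{ZVG}(z)=\sum_{\alpha=1}^3\Bigl[S_\alpha\varphi_\alpha(z)\bigl(E_1(z+\omega_\alpha)-E_1(\omega_\alpha)\bigr)+\tilde\nu_\alpha\varphi_\alpha(z-\omega_\alpha)E_1(z)\Bigr]\sigma_\alpha =-\sum_{\alpha=1}^3S_\alpha\frac{\varphi_1(z)\varphi_2(z)\varphi_3(z)}{\varphi_\alpha(z)}\sigma_\alpha+E_1(z)L^{ZVG}(z) $$ such that the Lax equation $\partial_tL^{ZVG}(z)=[L^{ZVG}(z),M^{ZVG}(z)]$ is equivalent to the autonomous $\mathrm{SL}(2,\mathbb C)$ Zhukovsky-Volterra gyrostat equation $$ \partial_t\vec S=\vec S\times(\vec J\cdot\vec S)+\vec S\times\vec\nu',\qquad \vec J\cdot\vec S=(J_1S_1,J_2S_2,J_3S_3),\quad J_\alpha=\wp(\omega_\alpha,\tau). $$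
   Context: $\tau$ is fixed in the upper half plane; $\vec S=(S_1,S_2,S_3)$ depends on $t$; $\tilde\nu_1,\tilde\nu_2,\tilde\nu_3$ are constants and $\vec\nu'=(\nu'_1,\nu'_2,\nu'_3)$ with $\nu'_\alpha=-\tilde\nu_\alpha\exp(-2\pi i\,\omega_\alpha\partial_\tau\omega_\alpha)\bigl(\vartheta'(0)/\vartheta(\omega_\alpha)\bigr)^2$. $\omega_1=\frac12$, $\omega_2=\frac\tau2$, $\omega_3=\frac{1+\tau}2$, so $\partial_\tau\omega_1=0$, $\partial_\tau\omega_2=\partial_\tau\omega_3=\frac12$. $\sigma_\alpha$ are the Pauli matrices. $\vartheta(z)=\sum_{j\in\mathbb Z}\exp\bigl(\pi i(j+\frac12)^2\tau+2\pi i(j+\frac12)(z+\frac12)\bigr)$, $E_1(z)=\partial_z\log\vartheta(z)$, $$\phi(u,z)=\frac{\vartheta(u+z)\vartheta'(0)}{\vartheta(u)\vartheta(z)},\qquad \varphi_\alpha(z)=\exp(2\pi i z\,\partial_\tau\omega_\alpha)\,\phi(z,\omega_\alpha).$$ $\wp(z,\tau)$ is the Weierstrass function of $\mathbb Z+\tau\mathbb Z$; $\times$ is the cross product on $\mathbb C^3$.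
   Formalization: With the Pauli matrices and L, M as printed, the Lax equation gives ∂_t S = −2i(S×(J·S) − S×ν'), not the printed equation; the printed gyrostat equation is shown equivalent after the constant change S → −S, t → 2it. *)

theory Defs
  imports "HOL-Complex_Analysis.Complex_Analysis"
begin

definition period_lattice :: "complex \<Rightarrow> complex set" where
  "period_lattice \<tau> = {of_int m + of_int n * \<tau> | m n. True}"

definition theta :: "complex \<Rightarrow> complex \<Rightarrow> complex" where
  "theta \<tau> z = (\<Sum>\<^sub>\<infinity>j\<in>(UNIV :: int set).
     exp (pi * \<i> * (of_int j + 1/2)^2 * \<tau> + 2 * pi * \<i> * (of_int j + 1/2) * (z + 1/2)))"

text \<open>The logarithmic derivative of \<open>theta\<close>, written as a quotient because no branch of the
  logarithm of \<open>theta\<close> exists on the whole domain.\<close>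

definition E1 :: "complex \<Rightarrow> complex \<Rightarrow> complex" where
  "E1 \<tau> z = deriv (theta \<tau>) z / theta \<tau> z"

definition kronecker_phi :: "complex \<Rightarrow> complex \<Rightarrow> complex \<Rightarrow> complex" where
  "kronecker_phi \<tau> u z =
     theta \<tau> (u + z) * deriv (theta \<tau>) 0 / (theta \<tau> u * theta \<tau> z)"

definition weierstrass_p :: "complex \<Rightarrow> complex \<Rightarrow> complex" where
  "weierstrass_p \<tau> z = 1 / z^2 +
     (\<Sum>\<^sub>\<infinity>(m, n) \<in> UNIV - {(0 :: int, 0 :: int)}.
        1 / (z - (of_int m + of_int n * \<tau>))^2 - 1 / (of_int m + of_int n * \<tau>)^2)"

definition omega :: "complex \<Rightarrow> complex^3" where
  "omega \<tau> = vector [1/2, \<tau>/2, (1 + \<tau>)/2]"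

definition d_omega :: "complex \<Rightarrow> complex^3" where
  "d_omega \<tau> = (\<chi> \<alpha>. deriv (\<lambda>s. omega s $ \<alpha>) \<tau>)"

definition phi :: "complex \<Rightarrow> 3 \<Rightarrow> complex \<Rightarrow> complex" where
  "phi \<tau> \<alpha> z = exp (2 * pi * \<i> * z * d_omega \<tau> $ \<alpha>) * kronecker_phi \<tau> z (omega \<tau> $ \<alpha>)"

text \<open>The library's \<open>cross3\<close> and \<open>*\<^sub>R\<close> are restricted to real vectors and scalars.\<close>

definition ccross :: "complex^3 \<Rightarrow> complex^3 \<Rightarrow> complex^3"  (infixr \<open>\<times>\<^sub>c\<close> 80) where
  "a \<times>\<^sub>c b = vector [a$2 * b$3 - a$3 * b$2, a$3 * b$1 - a$1 * b$3, a$1 * b$2 - a$2 * b$1]"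

definition mat_scale :: "complex \<Rightarrow> complex^2^2 \<Rightarrow> complex^2^2"  (infixr \<open>*\<^sub>m\<close> 75) where
  "c *\<^sub>m A = (\<chi> i j. c * A $ i $ j)"

definition commutator :: "complex^2^2 \<Rightarrow> complex^2^2 \<Rightarrow> complex^2^2" where
  "commutator A B = A ** B - B ** A"

definition pauli :: "complex^2^2^3" where
  "pauli = vector
     [vector [vector [0, 1], vector [1, 0]],
      vector [vector [0, -\<i>], vector [\<i>, 0]],
      vector [vector [1, 0], vector [0, -1]]]"

definition nu' :: "complex \<Rightarrow> complex^3 \<Rightarrow> complex^3" where
  "nu' \<tau> \<nu> = (\<chi> \<alpha>. - (\<nu> $ \<alpha>) * exp (- 2 * pi * \<i> * omega \<tau> $ \<alpha> * d_omega \<tau> $ \<alpha>)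
                  * (deriv (theta \<tau>) 0 / theta \<tau> (omega \<tau> $ \<alpha>))^2)"

definition J_op :: "complex \<Rightarrow> complex^3 \<Rightarrow> complex^3" where
  "J_op \<tau> s = (\<chi> \<alpha>. weierstrass_p \<tau> (omega \<tau> $ \<alpha>) * s $ \<alpha>)"

text \<open>The Lax matrices live over the complement of the half-period lattice: there \<open>L\<close> and \<open>M\<close>
  have no poles and no \<open>phi\<close> vanishes.\<close>

definition spectral_domain :: "complex \<Rightarrow> complex set" where
  "spectral_domain \<tau> = {z. 2 * z \<notin> period_lattice \<tau>}"

definition L_ZVG :: "complex \<Rightarrow> complex^3 \<Rightarrow> complex^3 \<Rightarrow> complex \<Rightarrow> complex^2^2" where
  "L_ZVG \<tau> \<nu> s z = (\<Sum>\<alpha>\<in>UNIV.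
     (s $ \<alpha> * phi \<tau> \<alpha> z + \<nu> $ \<alpha> * phi \<tau> \<alpha> (z - omega \<tau> $ \<alpha>)) *\<^sub>m pauli $ \<alpha>)"

text \<open>In the next two definitions \<open>T\<close> is an arbitrary set of times: an open set gives complex
  time, a real interval (embedded in the complex plane) gives real time. A derivative of a vector
  or matrix is taken entrywise; its existence is part of the equation.\<close>

definition lax_equation ::
  "complex set \<Rightarrow> complex set \<Rightarrow> (complex \<Rightarrow> complex \<Rightarrow> complex^2^2) \<Rightarrow>
   (complex \<Rightarrow> complex \<Rightarrow> complex^2^2) \<Rightarrow> bool" where
  "lax_equation T Z L M \<longleftrightarrow> (\<forall>t\<in>T. \<forall>z\<in>Z. \<forall>i j.
     ((\<lambda>t. L t z $ i $ j) has_field_derivative commutator (L t z) (M t z) $ i $ j)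
       (at t within T))"

definition solves_ode ::
  "complex set \<Rightarrow> (complex^3 \<Rightarrow> complex^3) \<Rightarrow> (complex \<Rightarrow> complex^3) \<Rightarrow> bool" where
  "solves_ode T F S \<longleftrightarrow> (\<forall>t\<in>T. \<forall>\<alpha>.
     ((\<lambda>t. S t $ \<alpha>) has_field_derivative F (S t) $ \<alpha>) (at t within T))"

text \<open>Normalisation: Pauli matrices satisfy \<open>[x\<cdot>\<sigma>, y\<cdot>\<sigma>] = 2\<i> (x \<times>\<^sub>c y)\<cdot>\<sigma>\<close>, so the Lax equation
  reads \<open>S' = -2\<i> (S \<times>\<^sub>c J S - S \<times>\<^sub>c \<nu>')\<close>. The constant rescaling \<open>r = 2\<i> t\<close>, \<open>R r = - S t\<close>
  turns this into the gyrostat equation \<open>R' = R \<times>\<^sub>c J R + R \<times>\<^sub>c \<nu>'\<close> with the same \<open>J\<close> and \<open>\<nu>'\<close>.\<close>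

end

theory Submission
  imports Defs
begin

text \<open>The functions \<open>phi \<tau> \<alpha>\<close> are odd, have multipliers \<open>\<plusminus>1\<close> along the periods and a simple pole with
  residue 1 on the lattice, so comparing principal parts at the origin and applying Liouville's
  theorem gives \<open>phi\<^sub>\<alpha>\<^sup>2 = \<wp> - \<wp>(\<omega>\<^sub>\<alpha>)\<close> and \<open>phi\<^sub>\<alpha>' = - phi\<^sub>\<beta> phi\<^sub>\<gamma>\<close>. Together with
  \<open>E1(\<omega>\<^sub>\<alpha>) = - 2 \<pi> \<i> \<partial>\<omega>\<^sub>\<alpha>\<close> the latter yields the second form of \<open>M\<close>. In the commutator the term
  \<open>E1 L\<close> drops out, and the differences \<open>phi\<^sub>\<beta>\<^sup>2 - phi\<^sub>\<gamma>\<^sup>2 = J\<^sub>\<gamma> - J\<^sub>\<beta>\<close> do not depend on \<open>z\<close>, so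
  each Pauli component of the Lax equation is \<open>phi\<^sub>\<alpha>(z)\<close> times a component of the gyrostat equation.
  The zeros of \<open>theta\<close> are found by the same Liouville argument, applied to its quotient by an
  explicit infinite product.\<close>

subsection \<open>The period lattice\<close>

text \<open>Everything divides by \<open>theta\<close>, whose series hides its zeros. Its
  multipliers are visible, though, and the explicit product has the same multipliers and visible
  zeros; a constant quotient transfers the zeros once a Fourier coefficient shows that the constant
  is not 0. Liouville's theorem is set up for multipliers of modulus one rather than for periodic
  functions, because \<open>phi\<close> and its derivative are periodic only up to sign. All poles
  are translates of 0, so an expansion at 0 is the only local computation. Oddness of
  \<open>phi\<close> removes its constant term there, which is why no term in 1/z survives in
  squares or products. The two constants left by Liouville are found in different ways: for the
  square at the zero \<omega>_\<alpha> of \<open>phi\<close>, for the derivative because a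
  nontrivial sign forces the constant to be 0.\<close>

lemma period_latticeI [intro]: "of_int m + of_int n * \<tau> \<in> period_lattice \<tau>"
  by (auto simp: period_lattice_def)

lemma zero_in_period_lattice [simp]: "0 \<in> period_lattice \<tau>"
  using period_latticeI[of 0 0 \<tau>] by simp

lemma one_in_period_lattice [simp]: "1 \<in> period_lattice \<tau>"
  using period_latticeI[of 1 0 \<tau>] by simp

lemma tau_in_period_lattice [simp]: "\<tau> \<in> period_lattice \<tau>"
  using period_latticeI[of 0 1 \<tau>] by simp

lemma period_lattice_add:
  "x \<in> period_lattice \<tau> \<Longrightarrow> y \<in> period_lattice \<tau> \<Longrightarrow> x + y \<in> period_lattice \<tau>"
proof -
  assume "x \<in> period_lattice \<tau>" "y \<in> period_lattice \<tau>"
  then obtain a b c d :: int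
    where "x = of_int a + of_int b * \<tau>" "y = of_int c + of_int d * \<tau>"
    by (auto simp: period_lattice_def)
  hence "x + y = of_int (a + c) + of_int (b + d) * \<tau>" by (simp add: algebra_simps)
  thus ?thesis by (simp only: period_latticeI)
qed

lemma period_lattice_minus: "x \<in> period_lattice \<tau> \<Longrightarrow> - x \<in> period_lattice \<tau>"
proof -
  assume "x \<in> period_lattice \<tau>"
  then obtain a b :: int where "x = of_int a + of_int b * \<tau>"
    by (auto simp: period_lattice_def)
  hence "- x = of_int (- a) + of_int (- b) * \<tau>" by (simp add: algebra_simps)
  thus ?thesis by (simp only: period_latticeI)
qed

lemma period_lattice_minus_iff [simp]: "- x \<in> period_lattice \<tau> \<longleftrightarrow> x \<in> period_lattice \<tau>"
  using period_lattice_minus[of x] period_lattice_minus[of "- x"] by auto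

lemma period_lattice_add_iff:
  assumes "y \<in> period_lattice \<tau>"
  shows "x + y \<in> period_lattice \<tau> \<longleftrightarrow> x \<in> period_lattice \<tau>"
  using period_lattice_add[of x \<tau> y] period_lattice_add[of "x + y" \<tau> "- y"] assms by auto

lemma period_lattice_diff_iff:
  assumes "y \<in> period_lattice \<tau>"
  shows "x - y \<in> period_lattice \<tau> \<longleftrightarrow> x \<in> period_lattice \<tau>"
  using period_lattice_add_iff[of "- y" \<tau> x] assms by simp

lemma countable_period_lattice: "countable (period_lattice \<tau>)"
proof -
  have "period_lattice \<tau> = range (\<lambda>(m :: int, n :: int). of_int m + of_int n * \<tau>)"
    by (auto simp: period_lattice_def)
  thus ?thesis by simp
qed

text \<open>A countable set does not disconnect the plane. This is what makes a function with
  derivative 0 off the lattice constant there, in the proof that \<open>weierstrass_p\<close> is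
  periodic.\<close>

lemma connected_Compl_period_lattice: "connected (- period_lattice \<tau>)"
  by (intro path_connected_imp_connected path_connected_complement_countable
      countable_period_lattice) simp

context
  fixes \<tau> :: complex
  assumes tau: "Im \<tau> > 0"
begin

lemma lattice_point_eq_iff:
  "of_int m + of_int n * \<tau> = of_int m' + of_int n' * \<tau> \<longleftrightarrow> m = m' \<and> n = n'"
proof
  assume *: "of_int m + of_int n * \<tau> = of_int m' + of_int n' * \<tau>"
  have "Im (of_int m + of_int n * \<tau>) = Im (of_int m' + of_int n' * \<tau>)" using * by simp
  hence n: "n = n'" using tau by simp
  with * show "m = m' \<and> n = n'" by simp
qed auto

lemma lattice_point_eq_0_iff: "of_int m + of_int n * \<tau> = 0 \<longleftrightarrow> m = 0 \<and> n = 0"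
  using lattice_point_eq_iff[of m n 0 0] by simp

text \<open>For l = m + n \<tau> the imaginary part bounds n, and then m = l - n \<tau> is bounded
  too; K adds the constants of the two estimates. Discreteness of the lattice and convergence of the
  series of inverse cubes both rest on this bound.\<close>

lemma norm_lattice_point_ge:
  obtains K where "K > 0" "\<And>m n. \<bar>of_int m\<bar> + \<bar>of_int n\<bar> \<le> K * norm (of_int m + of_int n * \<tau>)"
proof
  define K where "K = (1 + norm \<tau>) / Im \<tau> + 1"
  show "K > 0" using tau by (simp add: K_def add_nonneg_pos)
  fix m n :: int
  let ?l = "of_int m + of_int n * \<tau>"
  have "\<bar>Im ?l\<bar> \<le> norm ?l" by (rule abs_Im_le_cmod)
  hence 1: "\<bar>of_int n\<bar> \<le> norm ?l / Im \<tau>" using tau by (simp add: abs_mult field_simps)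
  have "norm (of_int m :: complex) = norm (?l - of_int n * \<tau>)" by simp
  also have "\<dots> \<le> norm ?l + norm (of_int n * \<tau>)" by (rule norm_triangle_ineq4)
  also have "\<dots> = norm ?l + \<bar>of_int n\<bar> * norm \<tau>" by (simp add: norm_mult)
  also have "\<dots> \<le> norm ?l + norm ?l / Im \<tau> * norm \<tau>"
    using 1 by (intro add_mono mult_right_mono) auto
  finally have "\<bar>of_int m\<bar> \<le> norm ?l + norm ?l / Im \<tau> * norm \<tau>" by simp
  with 1 have "\<bar>of_int m\<bar> + \<bar>of_int n\<bar> \<le> norm ?l / Im \<tau> + norm ?l + norm ?l / Im \<tau> * norm \<tau>"
    by linarith
  also have "\<dots> = K * norm ?l" using tau by (simp add: K_def field_simps)
  finally show "\<bar>of_int m\<bar> + \<bar>of_int n\<bar> \<le> K * norm ?l" .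
qed

lemma lattice_separated:
  obtains e where "e > 0" "\<And>l. l \<in> period_lattice \<tau> \<Longrightarrow> l \<noteq> 0 \<Longrightarrow> norm l \<ge> e"
proof -
  obtain K where K: "K > 0" "\<And>m n. \<bar>of_int m\<bar> + \<bar>of_int n\<bar> \<le> K * norm (of_int m + of_int n * \<tau>)"
    using norm_lattice_point_ge by blast
  show ?thesis
  proof (rule that)
    show "1 / K > 0" using K by simp
    fix l assume "l \<in> period_lattice \<tau>" "l \<noteq> 0"
    then obtain m n :: int where l: "l = of_int m + of_int n * \<tau>"
      by (auto simp: period_lattice_def)
    with \<open>l \<noteq> 0\<close> have "m \<noteq> 0 \<or> n \<noteq> 0" by auto
    hence "\<bar>m\<bar> + \<bar>n\<bar> \<ge> 1" by linarith
    hence "real_of_int (\<bar>m\<bar> + \<bar>n\<bar>) \<ge> 1" by linarith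
    also have "real_of_int (\<bar>m\<bar> + \<bar>n\<bar>) \<le> K * norm l" using K(2)[of m n] l by simp
    finally show "norm l \<ge> 1 / K" using K(1) by (simp add: field_simps)
  qed
qed

text \<open>Arbitrary subsets are allowed because later uses delete one point l from the lattice:
  the complement of the rest is an open neighbourhood of l in which l is the only possible
  singularity.\<close>

lemma closed_subset_lattice:
  assumes "A \<subseteq> period_lattice \<tau>"
  shows "closed A"
proof -
  obtain e where e: "e > 0" "\<And>l. l \<in> period_lattice \<tau> \<Longrightarrow> l \<noteq> 0 \<Longrightarrow> norm l \<ge> e"
    using lattice_separated by blast
  show ?thesis
  proof (rule discrete_imp_closed[OF e(1)], safe)
    fix x y assume "x \<in> A" "y \<in> A" "dist y x < e"
    moreover from this have "y - x \<in> period_lattice \<tau>"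
      using assms by (subst period_lattice_diff_iff) auto
    ultimately show "y = x" using e(2)[of "y - x"] by (force simp: dist_norm)
  qed
qed

lemma open_Compl_lattice: "open (- period_lattice \<tau>)"
  using closed_subset_lattice[of "period_lattice \<tau>"] by auto

lemma eventually_notin_lattice: "\<forall>\<^sub>F z in at l. z \<notin> period_lattice \<tau>"
proof -
  have "open (- (period_lattice \<tau> - {l}))"
    using closed_subset_lattice[of "period_lattice \<tau> - {l}"] open_Compl by blast
  hence "\<forall>\<^sub>F z in at l. z \<in> - (period_lattice \<tau> - {l}) - {l}"
    by (intro eventually_at_in_open) auto
  thus ?thesis by eventually_elim auto
qed

section \<open>Liouville's theorem for functions with multipliers of modulus one\<close>

lemma lattice_reduction:
  obtains l s t where "l \<in> period_lattice \<tau>" "s \<in> {0..1}" "t \<in> {0..1::real}"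
    "z = l + (of_real s + of_real t * \<tau>)"
proof -
  define t where "t = Im z / Im \<tau>"
  define s where "s = Re z - t * Re \<tau>"
  have z: "z = of_real s + of_real t * \<tau>"
    using tau by (auto simp: complex_eq_iff s_def t_def)
  show ?thesis
  proof (rule that)
    show "of_int \<lfloor>s\<rfloor> + of_int \<lfloor>t\<rfloor> * \<tau> \<in> period_lattice \<tau>" by (rule period_latticeI)
    show "frac s \<in> {0..1}" "frac t \<in> {0..1}" by (auto simp: frac_ge_0 less_imp_le frac_lt_1)
    show "z = of_int \<lfloor>s\<rfloor> + of_int \<lfloor>t\<rfloor> * \<tau> + (of_real (frac s) + of_real (frac t) * \<tau>)"
      unfolding z frac_def by (simp add: algebra_simps)
  qed
qed

text \<open>The multiplier of m + n \<tau> is a^m b^n, obtained by a two-sided induction along each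
  of the two periods. Only its modulus is kept, since boundedness asks for nothing more.\<close>

lemma multiplier_lattice:
  assumes one: "\<And>z. z \<notin> period_lattice \<tau> \<Longrightarrow> f (z + 1) = a * f z"
    and tau': "\<And>z. z \<notin> period_lattice \<tau> \<Longrightarrow> f (z + \<tau>) = b * f z"
    and ab: "norm a = 1" "norm b = 1"
    and l: "l \<in> period_lattice \<tau>"
  obtains c :: complex where "norm c = 1" "\<And>z. z \<notin> period_lattice \<tau> \<Longrightarrow> f (z + l) = c * f z"
proof -
  let ?P = "\<lambda>l. \<exists>c. norm c = 1 \<and> (\<forall>z. z \<notin> period_lattice \<tau> \<longrightarrow> f (z + l) = c * (f z :: complex))"
  have multiple: "?P (of_int m * w)"
    if w: "w \<in> period_lattice \<tau>" and a: "norm a = 1"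
      and eq: "\<And>z. z \<notin> period_lattice \<tau> \<Longrightarrow> f (z + w) = a * f z" for m :: int and w a
  proof -
    have a0: "a \<noteq> 0" using a by auto
    have mult: "of_int m * w \<in> period_lattice \<tau>" for m :: int
    proof -
      obtain p q :: int where "w = of_int p + of_int q * \<tau>"
        using w by (auto simp: period_lattice_def)
      hence "of_int m * w = of_int (m * p) + of_int (m * q) * \<tau>" by (simp add: algebra_simps)
      thus ?thesis by (simp only: period_latticeI)
    qed
    have "f (z + of_int m * w) = a powi m * f z" if z: "z \<notin> period_lattice \<tau>" for z
    proof (induction m rule: int_induct[where k = 0])
      case base
      then show ?case by simp
    next
      case (step1 i)
      have "f (z + of_int (i + 1) * w) = f ((z + of_int i * w) + w)" by (simp add: algebra_simps)
      also have "\<dots> = a * f (z + of_int i * w)"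
        using z by (intro eq) (simp add: period_lattice_add_iff mult)
      finally show ?case using step1 a0 by (simp add: power_int_add)
    next
      case (step2 i)
      have "f (z + of_int i * w) = f ((z + of_int (i - 1) * w) + w)" by (simp add: algebra_simps)
      also have "\<dots> = a * f (z + of_int (i - 1) * w)"
        using z mult by (intro eq) (metis period_lattice_add_iff)
      finally show ?case using step2 a0 by (simp add: power_int_diff field_simps)
    qed
    moreover have "norm (a powi m) = 1" using a by (simp add: norm_power_int)
    ultimately show ?thesis by blast
  qed
  obtain m n :: int where l': "l = of_int m + of_int n * \<tau>"
    using l by (auto simp: period_lattice_def)
  from multiple[of 1 a m] one ab obtain c where
    c: "norm c = 1" "\<And>z. z \<notin> period_lattice \<tau> \<Longrightarrow> f (z + of_int m) = c * f z" by auto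
  from multiple[of \<tau> b n] tau' ab obtain d where
    d: "norm d = 1" "\<And>z. z \<notin> period_lattice \<tau> \<Longrightarrow> f (z + of_int n * \<tau>) = d * f z" by auto
  have m: "of_int m \<in> period_lattice \<tau>" using period_latticeI[of m 0 \<tau>] by simp
  show ?thesis
  proof (rule that[of "c * d"])
    show "norm (c * d) = 1" using c d by (simp add: norm_mult)
    fix z assume z: "z \<notin> period_lattice \<tau>"
    have "f (z + l) = f ((z + of_int m) + of_int n * \<tau>)" by (simp add: l' add_ac)
    also have "\<dots> = d * f (z + of_int m)"
      using z m by (intro d) (simp add: period_lattice_add_iff)
    finally show "f (z + l) = c * d * f z" using c z by simp
  qed
qed

text \<open>One limit at 0 is enough: the multipliers carry it to every lattice point up to a factor
  of modulus one, so all singularities are removable. The modulus of f is periodic, so a bound on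
  one compact parallelogram bounds the entire extension.\<close>

lemma elliptic_constant:
  assumes hol: "f holomorphic_on - period_lattice \<tau>"
    and one: "\<And>z. z \<notin> period_lattice \<tau> \<Longrightarrow> f (z + 1) = a * f z"
    and tau': "\<And>z. z \<notin> period_lattice \<tau> \<Longrightarrow> f (z + \<tau>) = b * f z"
    and ab: "norm a = 1" "norm b = 1"
    and lim: "f \<midarrow>0\<rightarrow> L"
  obtains C where "\<And>z. z \<notin> period_lattice \<tau> \<Longrightarrow> f z = C"
proof -
  define F where "F = remove_sings f"
  have mult: "\<exists>c. norm c = 1 \<and> (\<forall>z. z \<notin> period_lattice \<tau> \<longrightarrow> f (z + l) = c * f z)"
    if "l \<in> period_lattice \<tau>" for l
    using multiplier_lattice[of f a b l] one tau' ab that by metis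
  have ana: "f analytic_on {z}" if "z \<notin> period_lattice \<tau>" for z
    using hol open_Compl_lattice that by (auto simp: analytic_at)
  have lims: "\<exists>c. norm c = 1 \<and> f \<midarrow>l\<rightarrow> c * L" if l: "l \<in> period_lattice \<tau>" for l
  proof -
    from mult[OF l] obtain c
      where c: "norm c = 1" "\<And>z. z \<notin> period_lattice \<tau> \<Longrightarrow> f (z + l) = c * f z" by blast
    have "((\<lambda>z. c * f z) \<longlongrightarrow> c * L) (at 0)" by (intro tendsto_intros lim)
    moreover have "\<forall>\<^sub>F z in at 0. c * f z = f (z + l)"
      using eventually_notin_lattice by eventually_elim (simp add: c)
    ultimately have "((\<lambda>z. f (z + l)) \<longlongrightarrow> c * L) (at 0)"
      by (rule Lim_transform_eventually)
    hence "f \<midarrow>l\<rightarrow> c * L" using LIM_offset_zero_cancel[of f l "c * L"] by (simp add: add_ac)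
    with c show ?thesis by blast
  qed
  have F_eq: "F z = f z" if "z \<notin> period_lattice \<tau>" for z
    unfolding F_def using ana[OF that] by simp
  have "F analytic_on {z}" for z
  proof (cases "z \<in> period_lattice \<tau>")
    case True
    have "open (- (period_lattice \<tau> - {z}))"
      using closed_subset_lattice[of "period_lattice \<tau> - {z}"] open_Compl by blast
    moreover have "f holomorphic_on - (period_lattice \<tau> - {z}) - {z}"
      by (rule holomorphic_on_subset[OF hol]) auto
    ultimately have "isolated_singularity_at f z"
      by (intro isolated_singularity_at_holomorphic) auto
    thus ?thesis using lims[OF True] remove_sings_analytic_at unfolding F_def by blast
  next
    case False
    thus ?thesis unfolding F_def using ana remove_sings_analytic_on by blast
  qed
  hence F_hol: "F holomorphic_on UNIV"
    using analytic_on_analytic_at analytic_imp_holomorphic by blast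
  define K where "K = (\<lambda>(s, t). of_real s + of_real t * \<tau>) ` ({0..1} \<times> {0..1::real})"
  have "compact K" unfolding K_def
    by (intro compact_continuous_image compact_Times)
       (auto simp: case_prod_unfold intro!: continuous_intros)
  hence "bounded (F ` K)"
    using F_hol by (intro compact_imp_bounded compact_continuous_image
        holomorphic_on_imp_continuous_on) (auto intro: holomorphic_on_subset)
  then obtain B where B: "\<And>z. z \<in> K \<Longrightarrow> norm (F z) \<le> B" by (auto simp: bounded_iff)
  \<comment> \<open>The multiplier equations are available off the lattice only; at lattice points
    the bound comes from the limits instead.\<close>
  have "norm (F z) \<le> max B (norm L)" for z
  proof (cases "z \<in> period_lattice \<tau>")
    case True
    from lims[OF True] obtain c where c: "norm c = 1" "f \<midarrow>z\<rightarrow> c * L" by blast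
    hence "F z = c * L" unfolding F_def by blast
    thus ?thesis using c by (simp add: norm_mult)
  next
    case False
    obtain l s t where l: "l \<in> period_lattice \<tau>" and st: "s \<in> {0..1}" "t \<in> {0..1::real}"
      and z: "z = l + (of_real s + of_real t * \<tau>)"
      using lattice_reduction by blast
    define w where "w = of_real s + of_real t * \<tau>"
    have w: "w \<in> K" using st unfolding K_def w_def by force
    have zw: "z = w + l" unfolding w_def z by simp
    hence "w \<notin> period_lattice \<tau>" using False l period_lattice_add_iff by metis
    moreover from mult[OF l] obtain c
      where "norm c = 1" "\<And>z. z \<notin> period_lattice \<tau> \<Longrightarrow> f (z + l) = c * f z" by blast
    ultimately have "norm (F z) = norm (F w)"
      using False by (simp add: F_eq zw norm_mult)
    thus ?thesis using B[OF w] by simp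
  qed
  hence "bounded (range F)" by (auto simp: bounded_iff)
  hence "F constant_on UNIV" using F_hol Liouville_theorem by blast
  thus ?thesis using that F_eq by (metis constant_on_def UNIV_I)
qed

end

lemma summable_on_int_even:
  fixes g :: "nat \<Rightarrow> real"
  assumes "summable g" "\<And>n. g n \<ge> 0"
  shows "(\<lambda>m::int. g (nat \<bar>m\<bar>)) summable_on UNIV"
proof -
  have g: "g summable_on UNIV" using assms by (simp add: summable_on_UNIV_nonneg_real_iff)
  have "(\<lambda>m::int. g (nat \<bar>m\<bar>)) summable_on range int"
    using g by (subst summable_on_reindex) (auto simp: o_def)
  moreover have "(\<lambda>m::int. g (nat \<bar>m\<bar>)) summable_on range (\<lambda>n. - int n)"
    using g by (subst summable_on_reindex) (auto simp: o_def inj_on_def)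
  moreover have "(UNIV :: int set) = range int \<union> (range (\<lambda>n. - int n) - range int)"
    by (auto simp: image_iff) (metis int_cases2)
  ultimately show ?thesis
    by (metis Diff_disjoint summable_on_Un_disjoint summable_on_subset_banach Diff_subset)
qed

subsection \<open>The theta series\<close>

definition theta_term :: "complex \<Rightarrow> int \<Rightarrow> complex \<Rightarrow> complex" where
  "theta_term \<tau> j z =
     exp (pi * \<i> * (of_int j + 1/2)^2 * \<tau> + 2 * pi * \<i> * (of_int j + 1/2) * (z + 1/2))"

lemma theta_eq: "theta \<tau> z = (\<Sum>\<^sub>\<infinity>j. theta_term \<tau> j z)"
  by (simp add: theta_def theta_term_def)

lemma exp_2pi_i_half_int: "exp (2 * pi * \<i> * (of_int j + 1/2)) = -1"
proof -
  have "exp (2 * pi * \<i> * (of_int j + 1/2)) = exp (pi * \<i> + \<i> * (of_int j * (of_real pi * 2)))"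
    by (simp add: algebra_simps)
  also have "\<dots> = -1" by (simp only: exp_plus_2pin exp_pi_i)
  finally show ?thesis .
qed

lemma theta_add_1: "theta \<tau> (z + 1) = - theta \<tau> z"
proof -
  have "theta_term \<tau> j (z + 1) = - theta_term \<tau> j z" for j
  proof -
    have "theta_term \<tau> j (z + 1) = theta_term \<tau> j z * exp (2 * pi * \<i> * (of_int j + 1/2))"
      unfolding theta_term_def exp_add[symmetric] by (rule arg_cong[of _ _ exp]) algebra
    thus ?thesis by (simp only: exp_2pi_i_half_int) simp
  qed
  thus ?thesis by (simp add: theta_eq infsum_uminus)
qed

text \<open>Completing the square, (j + 1/2)^2 + 2 (j + 1/2) = (j + 3/2)^2 - 1, turns the shift by
  \<tau> into the index shift from j to j + 1. The sign comes from the 1/2 added to z in the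
  series.\<close>

lemma theta_add_tau: "theta \<tau> (z + \<tau>) = - exp (- pi * \<i> * \<tau> - 2 * pi * \<i> * z) * theta \<tau> z"
proof -
  let ?c = "- exp (- pi * \<i> * \<tau> - 2 * pi * \<i> * z)"
  have "theta_term \<tau> j (z + \<tau>) = ?c * theta_term \<tau> (j + 1) z" for j
  proof -
    have "?c = exp (- pi * \<i>) * exp (- pi * \<i> * \<tau> - 2 * pi * \<i> * z)"
      by (simp add: exp_minus)
    hence "?c * theta_term \<tau> (j + 1) z = exp (- pi * \<i>) * exp (- pi * \<i> * \<tau> - 2 * pi * \<i> * z) *
        theta_term \<tau> (j + 1) z" by simp
    also have "\<dots> = theta_term \<tau> j (z + \<tau>)"
      unfolding theta_term_def exp_add[symmetric]
      by (rule arg_cong[of _ _ exp]) (simp add: field_simps power2_eq_square)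
    finally show ?thesis by simp
  qed
  hence "theta \<tau> (z + \<tau>) = (\<Sum>\<^sub>\<infinity>j. ?c * theta_term \<tau> (j + 1) z)" by (simp add: theta_eq)
  also have "\<dots> = (\<Sum>\<^sub>\<infinity>j. ?c * theta_term \<tau> j z)"
    by (rule infsum_reindex_bij_witness[of _ "\<lambda>j. j - 1" "\<lambda>j. j + 1"]) auto
  finally show ?thesis by (simp add: theta_eq infsum_cmult_right' infsum_uminus)
qed

text \<open>The reflection of the index j to -1 - j negates j + 1/2; the sign is again due to the
  1/2 added to z.\<close>

lemma theta_minus: "theta \<tau> (- z) = - theta \<tau> z"
proof -
  have "theta_term \<tau> j (- z) = - theta_term \<tau> (- 1 - j) z" for j
  proof -
    have "theta_term \<tau> (- 1 - j) z * exp (2 * pi * \<i> * (of_int j + 1/2)) = theta_term \<tau> j (- z)"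
      unfolding theta_term_def exp_add[symmetric]
      by (rule arg_cong[of _ _ exp]) (simp add: field_simps power2_eq_square)
    thus ?thesis by (simp only: exp_2pi_i_half_int) simp
  qed
  hence "theta \<tau> (- z) = (\<Sum>\<^sub>\<infinity>j. - theta_term \<tau> (- 1 - j) z)" by (simp add: theta_eq)
  also have "\<dots> = (\<Sum>\<^sub>\<infinity>j. - theta_term \<tau> j z)"
    by (rule infsum_reindex_bij_witness[of _ "\<lambda>j. - 1 - j" "\<lambda>j. - 1 - j"]) auto
  finally show ?thesis by (simp add: theta_eq infsum_uminus)
qed

lemma theta_0 [simp]: "theta \<tau> 0 = 0"
  using theta_minus[of \<tau> 0] by simp

lemma theta_half_periods [simp]: "theta \<tau> 1 = 0" "theta \<tau> \<tau> = 0" "theta \<tau> (1 + \<tau>) = 0"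
  using theta_add_1[of \<tau> 0] theta_add_tau[of \<tau> 0] theta_add_tau[of \<tau> 1] by auto

text \<open>The factor \<open>P\<close> of the product \<open>sin (\<pi> z) * P w * P (1 / w)\<close> with which
  \<open>theta\<close> is compared to locate its zeros.\<close>

lemma q_product:
  fixes q :: complex
  assumes q: "norm q < 1"
  obtains P where "P holomorphic_on UNIV" "\<And>w. P w = (1 - q * w) * P (q * w)"
    "\<And>w. (\<And>n. q ^ Suc n * w \<noteq> 1) \<Longrightarrow> P w \<noteq> 0"
proof
  define p where "p = (\<lambda>N w. \<Prod>n<N. 1 + - (q ^ Suc n * w))"
  define P where "P = (\<lambda>w. lim (\<lambda>N. p N w))"
  have sum: "summable (\<lambda>n. norm q ^ Suc n * R)" for R :: real
    using q by (intro summable_mult2) (simp add: summable_Suc_iff)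
  have ulim: "uniform_limit (cball 0 R) p P sequentially" for R
  proof -
    have "uniformly_convergent_on (cball 0 R) (\<lambda>N w. \<Sum>n<N. norm (- (q ^ Suc n * w)))"
      by (rule Weierstrass_m_test'[OF _ sum[of R]])
         (auto simp: norm_mult norm_power intro!: mult_left_mono)
    hence "uniformly_convergent_on (cball 0 R) p"
      unfolding p_def by (intro uniformly_convergent_on_prod) (auto intro!: continuous_intros)
    thus ?thesis unfolding P_def by (simp add: uniformly_convergent_uniform_limit_iff)
  qed
  have lim: "(\<lambda>N. p N w) \<longlonglongrightarrow> P w" for w
    using tendsto_uniform_limitI[OF ulim[of "norm w"]] by simp
  have "P holomorphic_on ball 0 R" for R
  proof (rule holomorphic_uniform_limit[OF _ ulim[of R]])
    show "\<forall>\<^sub>F n in sequentially. continuous_on (cball 0 R) (p n) \<and> p n holomorphic_on ball 0 R"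
      unfolding p_def by (intro always_eventually allI conjI)
        (auto intro!: continuous_intros holomorphic_intros)
  qed auto
  hence "P analytic_on {w}" for w
    by (auto simp: analytic_at intro!: exI[of _ "ball 0 (norm w + 1)"])
  thus "P holomorphic_on UNIV"
    using analytic_on_analytic_at analytic_imp_holomorphic by blast
  show "P w = (1 - q * w) * P (q * w)" for w
  proof (rule LIMSEQ_unique)
    show "(\<lambda>N. p (Suc N) w) \<longlonglongrightarrow> P w" by (rule LIMSEQ_Suc[OF lim])
    \<comment> \<open>Once the factor for n = 0 is split off, the others contain q^(n+2) w = q^(n+1)
      (q w) and are the factors of the product at q w.\<close>
    have "p (Suc N) w = (1 - q * w) * p N (q * w)" for N
      unfolding p_def prod.lessThan_Suc_shift by (simp add: mult_ac)
    thus "(\<lambda>N. p (Suc N) w) \<longlonglongrightarrow> (1 - q * w) * P (q * w)"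
      using tendsto_mult_left[OF lim] by simp
  qed
  show "P w \<noteq> 0" if w: "\<And>n. q ^ Suc n * w \<noteq> 1" for w
  proof -
    \<comment> \<open>A limit of nonzero partial products can still be 0; convergence in the sense
      of \<open>convergent_prod\<close> excludes this.\<close>
    have conv: "convergent_prod (\<lambda>n. 1 + - (q ^ Suc n * w))"
    proof (rule summable_imp_convergent_prod_complex)
      show "summable (\<lambda>n. norm (- (q ^ Suc n * w)))"
        using sum[of "norm w"] by (simp add: norm_mult norm_power)
    qed (use w in auto)
    have "P w = prodinf (\<lambda>n. 1 + - (q ^ Suc n * w))"
      unfolding P_def p_def using w by (intro prodinf_eq_lim'[symmetric] conv) auto
    also have "\<dots> \<noteq> 0" using w by (intro prodinf_nonzero conv) auto
    finally show ?thesis .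
  qed
qed

section \<open>Holomorphy and zeros of theta\<close>

context
  fixes \<tau> :: complex
  assumes tau: "Im \<tau> > 0"
begin

text \<open>One majorant per horizontal strip: the bound |Im z| + 1 covers a unit disc about z and
  gives holomorphy, the bound 0 covers the segment on which the Fourier coefficient is
  computed.\<close>

lemma theta_term_bound:
  obtains M where "M summable_on UNIV"
    "\<And>j z. \<bar>Im z\<bar> \<le> R \<Longrightarrow> norm (theta_term \<tau> j z) \<le> M j"
proof
  \<comment> \<open>The exponent has real part at most -a x^2 + (b - 1) |x| with x = j + 1/2. The
    extra 1 in b leaves the decay exp (-|x|) after b |x| is absorbed by completing the square; the
    1/2 in c pays for replacing |x| by |j|.\<close>
  define a b where "a = pi * Im \<tau>" and "b = 2 * pi * \<bar>R\<bar> + 1"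
  define c where "c = b\<^sup>2 / (4 * a) + 1 / 2"
  have a: "a > 0" using tau by (simp add: a_def)
  define M where "M = (\<lambda>j :: int. exp c * exp (- real (nat \<bar>j\<bar>)))"
  have "summable (\<lambda>n. exp (-1) ^ n :: real)" by (rule summable_geometric) simp
  hence "summable (\<lambda>n. exp (- real n))" by (simp flip: exp_of_nat_mult)
  thus "M summable_on UNIV"
    unfolding M_def by (intro summable_on_cmult_right summable_on_int_even) auto
  fix j :: int and z :: complex
  assume z: "\<bar>Im z\<bar> \<le> R"
  define x where "x = real_of_int j + 1 / 2"
  have x: "of_int j + 1 / 2 = complex_of_real x" by (simp add: x_def)
  have "Re (pi * \<i> * (of_int j + 1/2)^2 * \<tau> + 2 * pi * \<i> * (of_int j + 1/2) * (z + 1/2)) =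
      - a * x\<^sup>2 - 2 * pi * (x * Im z)"
    unfolding x by (simp add: a_def flip: of_real_power)
  also have "\<dots> \<le> - a * x\<^sup>2 + 2 * pi * (\<bar>x\<bar> * \<bar>R\<bar>)"
  proof -
    have "- (x * Im z) \<le> \<bar>x\<bar> * \<bar>Im z\<bar>" by (metis abs_ge_minus_self abs_mult)
    also have "\<dots> \<le> \<bar>x\<bar> * \<bar>R\<bar>" using z by (intro mult_left_mono) auto
    finally have "2 * pi * - (x * Im z) \<le> 2 * pi * (\<bar>x\<bar> * \<bar>R\<bar>)" by (intro mult_left_mono) auto
    thus ?thesis by simp
  qed
  also have "\<dots> = - a * \<bar>x\<bar>\<^sup>2 + b * \<bar>x\<bar> - \<bar>x\<bar>" by (simp add: b_def algebra_simps)
  also have "\<dots> \<le> b\<^sup>2 / (4 * a) - \<bar>x\<bar>"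
  proof -
    have "a * (\<bar>x\<bar> - b / (2 * a))\<^sup>2 \<ge> 0" using a by simp
    also have "a * (\<bar>x\<bar> - b / (2 * a))\<^sup>2 = a * \<bar>x\<bar>\<^sup>2 - b * \<bar>x\<bar> + b\<^sup>2 / (4 * a)"
      using a by (simp add: power2_eq_square field_simps)
    finally show ?thesis by simp
  qed
  also have "\<dots> \<le> c - real (nat \<bar>j\<bar>)" by (auto simp: c_def x_def)
  finally show "norm (theta_term \<tau> j z) \<le> M j"
    unfolding M_def theta_term_def norm_exp_eq_Re by (simp flip: exp_add)
qed

lemma theta_holomorphic: "theta \<tau> holomorphic_on UNIV"
proof -
  have "theta \<tau> analytic_on {z}" for z
  proof -
    obtain M where M: "M summable_on UNIV"
      "\<And>j w. \<bar>Im w\<bar> \<le> \<bar>Im z\<bar> + 1 \<Longrightarrow> norm (theta_term \<tau> j w) \<le> M j"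
      using theta_term_bound by blast
    have "\<bar>Im w\<bar> \<le> \<bar>Im z\<bar> + 1" if "w \<in> cball z 1" for w
      using that abs_Im_le_cmod[of "z - w"] by (simp add: dist_norm)
    hence "uniform_limit (cball z 1) (\<lambda>X w. \<Sum>j\<in>X. theta_term \<tau> j w)
        (\<lambda>w. \<Sum>\<^sub>\<infinity>j. theta_term \<tau> j w) (finite_subsets_at_top UNIV)"
      using M by (intro Weierstrass_m_test_general[of _ _ _ M]) auto
    hence ulim: "uniform_limit (cball z 1) (\<lambda>X w. \<Sum>j\<in>X. theta_term \<tau> j w)
        (theta \<tau>) (finite_subsets_at_top UNIV)" by (simp add: theta_eq[abs_def])
    have "theta \<tau> holomorphic_on ball z 1"
    proof (rule holomorphic_uniform_limit[OF _ ulim])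
      show "\<forall>\<^sub>F X in finite_subsets_at_top UNIV. continuous_on (cball z 1)
          (\<lambda>w. \<Sum>j\<in>X. theta_term \<tau> j w) \<and> (\<lambda>w. \<Sum>j\<in>X. theta_term \<tau> j w) holomorphic_on ball z 1"
        unfolding theta_term_def by (intro always_eventually allI conjI)
          (auto intro!: continuous_intros holomorphic_intros)
    qed auto
    thus ?thesis by (auto simp: analytic_at intro!: exI[of _ "ball z 1"])
  qed
  thus ?thesis using analytic_on_analytic_at analytic_imp_holomorphic by blast
qed

lemma theta_holomorphic' [holomorphic_intros]:
  "f holomorphic_on A \<Longrightarrow> (\<lambda>z. theta \<tau> (f z)) holomorphic_on A"
  using holomorphic_on_compose[of f A "theta \<tau>"] theta_holomorphic
  by (auto simp: o_def intro: holomorphic_on_subset)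

lemma theta_has_field_derivative: "(theta \<tau> has_field_derivative deriv (theta \<tau>) z) (at z)"
  using theta_holomorphic by (rule holomorphic_derivI) auto

lemma isCont_theta: "isCont (theta \<tau>) z"
  using theta_has_field_derivative DERIV_isCont by blast

text \<open>The zeroth Fourier coefficient of \<open>theta \<tau> z * exp (- \<pi> \<i> z)\<close> does not vanish.\<close>

lemma theta_not_identically_0: "\<exists>z. theta \<tau> z \<noteq> 0"
proof (rule ccontr)
  \<comment> \<open>The factor exp (-pi i z) moves the frequencies j + 1/2 to the integers j, so
    each \<open>h j\<close> has period 1 and only j = 0 survives integration from 0 to 1.\<close>
  define h where "h = (\<lambda>j z. theta_term \<tau> j z * exp (- pi * \<i> * z))"
  define c where "c = (\<lambda>j :: int. exp (pi * \<i> * (of_int j + 1/2)^2 * \<tau> + pi * \<i> * (of_int j + 1/2)))"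
  have h_eq: "h j z = c j * exp (2 * pi * \<i> * of_int j * z)" for j z
    unfolding h_def c_def theta_term_def exp_add[symmetric]
    by (rule arg_cong[of _ _ exp]) (simp add: algebra_simps)
  have int: "(h j has_contour_integral (if j = 0 then c 0 else 0)) (linepath 0 1)" for j
  proof (cases "j = 0")
    case True
    have "((\<lambda>z. c 0) has_contour_integral (c 0 * 1 - c 0 * 0)) (linepath 0 1)"
      using contour_integral_primitive[of UNIV "\<lambda>z. c 0 * z" "\<lambda>z. c 0" "linepath 0 1"]
      by (auto intro!: derivative_eq_intros)
    moreover have "h j = (\<lambda>z. c 0)" using True by (simp add: h_eq fun_eq_iff)
    ultimately show ?thesis using True by simp
  next
    case False
    define F where "F = (\<lambda>z. c j * exp (2 * pi * \<i> * of_int j * z) / (2 * pi * \<i> * of_int j))"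
    have "(F has_field_derivative h j z) (at z)" for z
      using False unfolding F_def h_eq by (auto intro!: derivative_eq_intros simp: field_simps)
    hence "(h j has_contour_integral (F 1 - F 0)) (linepath 0 1)"
      using contour_integral_primitive[of UNIV F "h j" "linepath 0 1"] by auto
    moreover have "F 1 = F 0"
      using exp_2pi_1_int[of j] by (simp add: F_def mult_ac)
    ultimately show ?thesis using False by simp
  qed
  assume "\<nexists>z. theta \<tau> z \<noteq> 0"
  hence zero: "theta \<tau> z = 0" for z by simp
  obtain M where M: "M summable_on UNIV"
      "\<And>j w. \<bar>Im w\<bar> \<le> 0 \<Longrightarrow> norm (theta_term \<tau> j w) \<le> M j"
    using theta_term_bound by blast
  have "uniform_limit (path_image (linepath 0 1)) (\<lambda>X z. \<Sum>j\<in>X. h j z)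
      (\<lambda>z. \<Sum>\<^sub>\<infinity>j. h j z) (finite_subsets_at_top UNIV)"
  proof (rule Weierstrass_m_test_general[OF _ M(1)])
    fix j z assume "z \<in> path_image (linepath 0 (1 :: complex))"
    hence "Im z = 0" by (auto simp: linepath_def path_image_def)
    thus "norm (h j z) \<le> M j" using M(2)[of z j] by (simp add: h_def norm_mult)
  qed
  also have "(\<lambda>z. \<Sum>\<^sub>\<infinity>j. h j z) = (\<lambda>z. 0)"
    using zero by (simp add: h_def infsum_cmult_left' theta_eq)
  finally have ulim: "uniform_limit (path_image (linepath 0 1)) (\<lambda>X z. \<Sum>j\<in>X. h j z)
      (\<lambda>z. 0) (finite_subsets_at_top UNIV)" .
  have int': "((\<lambda>z. \<Sum>j\<in>X. h j z) has_contour_integral (\<Sum>j\<in>X. if j = 0 then c 0 else 0))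
      (linepath 0 1)" if "finite X" for X
    using that by (intro has_contour_integral_sum int)
  \<comment> \<open>Uniform convergence lets the integral pass to the limit. The partial integrals
    equal \<open>c 0\<close> as soon as 0 lies in X, while the limit is the integral of the zero
    function.\<close>
  have "((\<lambda>X. contour_integral (linepath 0 1) (\<lambda>z. \<Sum>j\<in>X. h j z)) \<longlongrightarrow>
      contour_integral (linepath 0 1) (\<lambda>z. 0)) (finite_subsets_at_top UNIV)"
  proof (rule contour_integral_uniform_limit(2)[OF _ ulim])
    show "\<forall>\<^sub>F X in finite_subsets_at_top UNIV. (\<lambda>z. \<Sum>j\<in>X. h j z) contour_integrable_on linepath 0 1"
      using eventually_finite_subsets_at_top_weakI[of UNIV "\<lambda>X. finite X"]
      by (rule eventually_mono) (use int' in \<open>auto simp: contour_integrable_on_def\<close>)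
    show "norm (vector_derivative (linepath 0 (1 :: complex)) (at t)) \<le> 1" for t :: real
      by simp
  qed auto
  moreover have "\<forall>\<^sub>F X in finite_subsets_at_top UNIV.
      contour_integral (linepath 0 1) (\<lambda>z. \<Sum>j\<in>X. h j z) = c 0"
  proof -
    have "\<forall>\<^sub>F X in finite_subsets_at_top UNIV. finite X \<and> {0::int} \<subseteq> X"
      by (subst eventually_finite_subsets_at_top) (auto intro!: exI[of _ "{0}"])
    thus ?thesis
      by eventually_elim (use int' contour_integral_unique in fastforce)
  qed
  ultimately have "((\<lambda>X :: int set. c 0) \<longlongrightarrow> 0) (finite_subsets_at_top UNIV)"
    by (simp add: tendsto_cong)
  hence "c 0 = 0" by (simp add: tendsto_const_iff)
  thus False by (simp add: c_def)
qed

text \<open>The product f has the multipliers of \<open>theta\<close>, no zeros off the lattice and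
  a simple zero at 0. Since \<open>theta\<close> vanishes at 0, the quotient has a limit there and
  is a constant C; C \<noteq> 0 then yields both claims, the second by comparing the limits of the
  two functions divided by z.\<close>

lemma theta_zeros: "z \<notin> period_lattice \<tau> \<Longrightarrow> theta \<tau> z \<noteq> 0"
  and deriv_theta_0: "deriv (theta \<tau>) 0 \<noteq> 0"
proof -
  define q where "q = exp (2 * pi * \<i> * \<tau>)"
  have q: "norm q < 1" using tau by (simp add: q_def norm_exp_eq_Re)
  obtain P where P: "P holomorphic_on UNIV" "\<And>w. P w = (1 - q * w) * P (q * w)"
    "\<And>w. (\<And>n. q ^ Suc n * w \<noteq> 1) \<Longrightarrow> P w \<noteq> 0"
    using q_product[OF q] by blast
  define w where "w = (\<lambda>z. exp (2 * pi * \<i> * z))"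
  have cancel: "y = of_int k" if "2 * pi * \<i> * y = (of_int (2 * k) * pi) * \<i>"
    for y :: complex and k :: int
    using that by (simp add: field_simps)
  have P_nz: "P (w z) \<noteq> 0" if "z \<notin> period_lattice \<tau>" for z
  proof (rule P(3))
    fix n show "q ^ Suc n * w z \<noteq> 1"
    proof
      have "q ^ Suc n * w z = exp (2 * pi * \<i> * (of_nat (Suc n) * \<tau> + z))"
        by (simp add: q_def w_def exp_add exp_of_nat_mult[symmetric] algebra_simps
            del: exp_of_nat_mult power_Suc of_nat_Suc)
      moreover assume "q ^ Suc n * w z = 1"
      ultimately have "exp (2 * pi * \<i> * (of_nat (Suc n) * \<tau> + z)) = exp 0" by simp
      then obtain k :: int where "2 * pi * \<i> * (of_nat (Suc n) * \<tau> + z) = (of_int (2 * k) * pi) * \<i>"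
        unfolding exp_eq by auto
      hence "of_nat (Suc n) * \<tau> + z = of_int k" by (rule cancel)
      hence "z = of_int k + of_int (- int (Suc n)) * \<tau>" by (simp add: algebra_simps)
      thus False using that period_latticeI by metis
    qed
  qed
  have P1: "P 1 \<noteq> 0"
  proof (rule P(3))
    fix n show "q ^ Suc n * 1 \<noteq> 1"
    proof
      assume "q ^ Suc n * 1 = 1"
      hence "norm q ^ Suc n = 1" by (metis mult.right_neutral norm_one norm_power)
      thus False using q power_less_one_iff[of "norm q" "Suc n"] by simp
    qed
  qed
  \<comment> \<open>Up to a constant factor this is Jacobi's product for \<open>theta\<close>, as
    \<open>w (- z)\<close> is the reciprocal of \<open>w z\<close>. The factor is not computed, only
    shown to be nonzero.\<close>
  define f where "f = (\<lambda>z :: complex. sin (pi * z) * P (w z) * P (w (- z)))"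
  have hol_P: "(\<lambda>z. P (g z)) holomorphic_on A" if "g holomorphic_on A" for g :: "complex \<Rightarrow> complex" and A
    using holomorphic_on_compose[OF that] P(1) by (auto simp: o_def intro: holomorphic_on_subset)
  have f_hol: "f holomorphic_on A" for A
    unfolding f_def w_def by (intro holomorphic_intros hol_P)
  have sin_w: "sin (pi * z) = exp (- (pi * \<i> * z)) * (w z - 1) / (2 * \<i>)" for z :: complex
    by (simp add: sin_exp_eq w_def ring_distribs mult_ac flip: exp_add)
  have f_nz: "f z \<noteq> 0" if "z \<notin> period_lattice \<tau>" for z
  proof -
    have "w z \<noteq> 1"
    proof
      assume "w z = 1"
      hence "exp (2 * pi * \<i> * z) = exp 0" by (simp add: w_def)
      then obtain k :: int where "2 * pi * \<i> * z = (of_int (2 * k) * pi) * \<i>"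
        unfolding exp_eq by auto
      hence "z = of_int k + of_int 0 * \<tau>" by (simp add: field_simps)
      thus False using that period_latticeI by metis
    qed
    thus ?thesis using P_nz[of z] P_nz[of "- z"] that by (simp add: f_def sin_w)
  qed
  have w1: "w (z + 1) = w z" "w (- z - 1) = w (- z)" for z
    using exp_2pi_1_int[of 1] by (simp_all add: w_def ring_distribs exp_add exp_diff exp_minus mult_ac)
  have f1: "f (z + 1) = - f z" for z
    by (simp add: f_def w1 sin_w) (simp add: ring_distribs exp_diff exp_minus)
  \<comment> \<open>The shift by \<tau> replaces w by q w. The first product loses the factor 1 - q
    w, which the shifted sine supplies; the second gains 1 - 1/w, which becomes the sine of the
    unshifted f.\<close>
  have ftau: "f (z + \<tau>) = - exp (- pi * \<i> * \<tau> - 2 * pi * \<i> * z) * f z" for z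
  proof -
    have wt: "w (z + \<tau>) = q * w z" "q * w (- z - \<tau>) = w (- z)"
      by (simp_all add: w_def q_def ring_distribs add_ac flip: exp_add)
    have ww: "w z * w (- z) = 1" by (simp add: w_def flip: exp_add)
    have "f (z + \<tau>) = sin (pi * (z + \<tau>)) * P (q * w z) * ((1 - w (- z)) * P (w (- z)))"
      using P(2)[of "w (- z - \<tau>)"] by (simp add: f_def wt)
    also have "sin (pi * (z + \<tau>)) = exp (- (pi * \<i> * z)) * exp (- (pi * \<i> * \<tau>)) * (q * w z - 1) / (2 * \<i>)"
      unfolding sin_w wt by (simp add: ring_distribs flip: exp_add)
    also have "\<dots> * P (q * w z) = - exp (- (pi * \<i> * z)) * exp (- (pi * \<i> * \<tau>)) * P (w z) / (2 * \<i>)"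
      by (subst (2) P(2)) (simp add: field_simps)
    also have "\<dots> * ((1 - w (- z)) * P (w (- z))) =
        - exp (- (pi * \<i> * \<tau>)) * w (- z) * (exp (- (pi * \<i> * z)) * (w z - 1) / (2 * \<i>) * P (w z) * P (w (- z)))"
      using ww by (simp add: field_simps)
    also have "\<dots> = - exp (- (pi * \<i> * \<tau>)) * w (- z) * f z" by (simp add: f_def sin_w)
    also have "\<dots> = - exp (- pi * \<i> * \<tau> - 2 * pi * \<i> * z) * f z"
      by (simp add: w_def exp_diff exp_minus divide_inverse)
    finally show ?thesis by simp
  qed
  have lim_f: "((\<lambda>z. f z / z) \<longlongrightarrow> pi * P 1 * P 1) (at 0)"
  proof -
    have "((\<lambda>z. sin (pi * z)) has_field_derivative complex_of_real pi) (at 0)"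
      by (auto intro!: derivative_eq_intros)
    hence "((\<lambda>z :: complex. sin (pi * z) / z) \<longlongrightarrow> pi) (at 0)" by (simp add: DERIV_def)
    moreover have "continuous_on UNIV (\<lambda>z. P (w z) * P (w (- z)))"
      unfolding w_def by (intro holomorphic_on_imp_continuous_on holomorphic_intros hol_P)
    hence "((\<lambda>z. P (w z) * P (w (- z))) \<longlongrightarrow> P (w 0) * P (w (- 0))) (at 0)"
      unfolding continuous_on_def by blast
    hence "((\<lambda>z. P (w z) * P (w (- z))) \<longlongrightarrow> P 1 * P 1) (at 0)" by (simp add: w_def)
    ultimately have "((\<lambda>z :: complex. sin (pi * z) / z * (P (w z) * P (w (- z)))) \<longlongrightarrow> pi * (P 1 * P 1)) (at 0)"
      by (rule tendsto_mult)
    thus ?thesis by (simp add: f_def mult_ac)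
  qed
  have lim_theta: "((\<lambda>z. theta \<tau> z / z) \<longlongrightarrow> deriv (theta \<tau>) 0) (at 0)"
    using theta_has_field_derivative[of 0] by (simp add: DERIV_def)
  have "((\<lambda>z. (theta \<tau> z / z) / (f z / z)) \<longlongrightarrow> deriv (theta \<tau>) 0 / (pi * P 1 * P 1)) (at 0)"
    using P1 by (intro tendsto_intros lim_theta lim_f) auto
  moreover have "\<forall>\<^sub>F z in at 0. (theta \<tau> z / z) / (f z / z) = theta \<tau> z / f z"
    by (simp add: eventually_at_filter)
  ultimately have "((\<lambda>z. theta \<tau> z / f z) \<longlongrightarrow> deriv (theta \<tau>) 0 / (pi * P 1 * P 1)) (at 0)"
    by (rule Lim_transform_eventually)
  then obtain C where "\<And>z. z \<notin> period_lattice \<tau> \<Longrightarrow> theta \<tau> z / f z = C"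
  proof (rule elliptic_constant[OF tau, rotated 5])
    show "(\<lambda>z. theta \<tau> z / f z) holomorphic_on - period_lattice \<tau>"
      using f_nz by (intro holomorphic_intros f_hol) auto
    show "theta \<tau> (z + 1) / f (z + 1) = 1 * (theta \<tau> z / f z)" for z
      by (simp add: f1 theta_add_1)
    show "theta \<tau> (z + \<tau>) / f (z + \<tau>) = 1 * (theta \<tau> z / f z)" for z
      by (simp add: ftau theta_add_tau)
  qed auto
  hence C: "theta \<tau> z = C * f z" if "z \<notin> period_lattice \<tau>" for z
    using f_nz[OF that] that by (metis nonzero_eq_divide_eq)
  have "C \<noteq> 0"
  proof
    assume "C = 0"
    have "theta \<tau> z = 0" for z
    proof (rule tendsto_unique)
      show "theta \<tau> \<midarrow>z\<rightarrow> theta \<tau> z" using isCont_theta by (simp add: isCont_def)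
      have "\<forall>\<^sub>F x in at z. 0 = theta \<tau> x"
        using eventually_notin_lattice[OF tau] by eventually_elim (simp add: C \<open>C = 0\<close>)
      thus "theta \<tau> \<midarrow>z\<rightarrow> 0" by (rule Lim_transform_eventually[OF tendsto_const])
    qed auto
    thus False using theta_not_identically_0 by simp
  qed
  thus "theta \<tau> z \<noteq> 0" if "z \<notin> period_lattice \<tau>" using C f_nz that by simp
  have "((\<lambda>z. C * (f z / z)) \<longlongrightarrow> C * (pi * P 1 * P 1)) (at 0)"
    by (intro tendsto_intros lim_f)
  moreover have "\<forall>\<^sub>F z in at 0. C * (f z / z) = theta \<tau> z / z"
    using eventually_notin_lattice[OF tau] by eventually_elim (simp add: C)
  ultimately have "((\<lambda>z. theta \<tau> z / z) \<longlongrightarrow> C * (pi * P 1 * P 1)) (at 0)"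
    by (rule Lim_transform_eventually)
  hence "deriv (theta \<tau>) 0 = C * (pi * P 1 * P 1)"
    using lim_theta tendsto_unique by (metis at_neq_bot)
  thus "deriv (theta \<tau>) 0 \<noteq> 0" using \<open>C \<noteq> 0\<close> P1 by simp
qed

end

subsection \<open>The Weierstrass function\<close>

lemma DERIV_inverse_square:
  fixes l w :: complex
  assumes "w \<noteq> l"
  shows "((\<lambda>z. 1 / (z - l)\<^sup>2) has_field_derivative - 2 / (w - l) ^ 3) (at w)"
proof -
  have "- (2 * d) / (d\<^sup>2)\<^sup>2 = - 2 / d ^ 3" if "d \<noteq> 0" for d :: complex
    using that by (simp add: field_simps power2_eq_square power3_eq_cube)
  from this[of "w - l"] have eq: "- (2 * (w - l)) / ((w - l)\<^sup>2)\<^sup>2 = - 2 / (w - l) ^ 3"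
    using assms by simp
  have "((\<lambda>z. 1 / (z - l)\<^sup>2) has_field_derivative - (2 * (w - l)) / ((w - l)\<^sup>2)\<^sup>2) (at w)"
    using assms by (auto intro!: derivative_eq_intros simp: power2_eq_square)
  thus ?thesis unfolding eq .
qed

definition lattice_point :: "complex \<Rightarrow> int \<times> int \<Rightarrow> complex" where
  "lattice_point \<tau> p = of_int (fst p) + of_int (snd p) * \<tau>"

lemma lattice_point_in [simp]: "lattice_point \<tau> p \<in> period_lattice \<tau>"
  unfolding lattice_point_def by (rule period_latticeI)

lemma lattice_pointE:
  assumes "l \<in> period_lattice \<tau>"
  obtains p where "l = lattice_point \<tau> p"
  using assms by (force simp: period_lattice_def lattice_point_def)

lemma lattice_point_add: "lattice_point \<tau> (p + q) = lattice_point \<tau> p + lattice_point \<tau> q"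
  and lattice_point_minus: "lattice_point \<tau> (- p) = - lattice_point \<tau> p"
  by (simp_all add: lattice_point_def algebra_simps)

text \<open>The Weierstrass function without its pole at 0, hence holomorphic near 0 with value 0
  there; this is the form in which principal parts at 0 are compared.\<close>

definition wp_regular :: "complex \<Rightarrow> complex \<Rightarrow> complex" where
  "wp_regular \<tau> z = (\<Sum>\<^sub>\<infinity>p\<in>UNIV - {(0, 0)}. 1 / (z - lattice_point \<tau> p)\<^sup>2 - 1 / (lattice_point \<tau> p)\<^sup>2)"

lemma weierstrass_p_eq: "weierstrass_p \<tau> z = 1 / z\<^sup>2 + wp_regular \<tau> z"
  by (simp add: weierstrass_p_def wp_regular_def lattice_point_def case_prod_unfold)

lemma wp_regular_0: "wp_regular \<tau> 0 = 0"
  by (simp add: wp_regular_def)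

lemma weierstrass_p_minus: "weierstrass_p \<tau> (- z) = weierstrass_p \<tau> z"
proof -
  have "wp_regular \<tau> (- z) = wp_regular \<tau> z" unfolding wp_regular_def
    by (rule infsum_reindex_bij_witness[of _ uminus uminus])
       (auto simp: lattice_point_minus power2_eq_square algebra_simps)
  thus ?thesis by (simp add: weierstrass_p_eq)
qed

section \<open>Convergence, differentiation and periodicity of the Weierstrass function\<close>

context
  fixes \<tau> :: complex
  assumes tau: "Im \<tau> > 0"
begin

lemma half_lattice_iff:
  "(of_int a + of_int b * \<tau>) / 2 \<in> period_lattice \<tau> \<longleftrightarrow> even a \<and> even b"
proof
  assume "(of_int a + of_int b * \<tau>) / 2 \<in> period_lattice \<tau>"
  then obtain m n :: int where "(of_int a + of_int b * \<tau>) / 2 = of_int m + of_int n * \<tau>"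
    by (auto simp: period_lattice_def)
  hence "of_int a + of_int b * \<tau> = of_int (2 * m) + of_int (2 * n) * \<tau>"
    by (simp add: field_simps)
  hence "a = 2 * m \<and> b = 2 * n" unfolding lattice_point_eq_iff[OF tau] .
  thus "even a \<and> even b" by simp
next
  assume "even a \<and> even b"
  then obtain m n where "a = 2 * m" "b = 2 * n" by (auto elim!: evenE)
  hence "(of_int a + of_int b * \<tau>) / 2 = of_int m + of_int n * \<tau>" by (simp add: field_simps)
  thus "(of_int a + of_int b * \<tau>) / 2 \<in> period_lattice \<tau>" by (simp only: period_latticeI)
qed

lemma lattice_point_0_iff: "lattice_point \<tau> p = 0 \<longleftrightarrow> p = (0, 0)"
  using lattice_point_eq_0_iff[OF tau] by (cases p) (simp add: lattice_point_def)

text \<open>Up to a constant, |l|^3 dominates ((1 + |m|) (1 + |n|)) powr (3/2), so the double series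
  is bounded by a product of two series over the integers. The exponent 3 is shared equally between
  m and n, and 3/2 > 1 makes both factors converge.\<close>

lemma summable_lattice_cubes: "(\<lambda>p. 1 / norm (lattice_point \<tau> p) ^ 3) summable_on (UNIV - {(0, 0)})"
proof -
  obtain K where K: "K > 0" "\<And>m n. \<bar>of_int m\<bar> + \<bar>of_int n\<bar> \<le> K * norm (of_int m + of_int n * \<tau>)"
    using norm_lattice_point_ge[OF tau] by blast
  define g where "g = (\<lambda>m :: int. (1 + real (nat \<bar>m\<bar>)) powr (- (3/2)))"
  have "summable (\<lambda>n. real (Suc n) powr (- (3/2)))"
    by (subst summable_Suc_iff) (simp add: summable_real_powr_iff)
  hence "summable (\<lambda>n. (1 + real n) powr (- (3/2)))" by simp
  hence g: "g summable_on UNIV" unfolding g_def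
    using summable_on_int_even[of "\<lambda>n. (1 + real n) powr (- (3/2))"] by simp
  have "(\<lambda>(m, n). g m * g n) summable_on (UNIV \<times> UNIV)"
  proof (rule summable_on_SigmaI)
    fix m show "((\<lambda>n. case (m, n) of (m, n) \<Rightarrow> g m * g n) has_sum g m * infsum g UNIV) UNIV"
      using has_sum_cmult_right[OF has_sum_infsum[OF g]] by simp
    show "(\<lambda>m. g m * infsum g UNIV) summable_on UNIV" by (intro summable_on_cmult_left g)
  qed (auto simp: g_def)
  hence "(\<lambda>(m, n). g m * g n) summable_on (UNIV - {(0, 0)})"
    by (rule summable_on_subset_banach) auto
  hence "(\<lambda>p. (2 * K) ^ 3 * (case p of (m, n) \<Rightarrow> g m * g n)) summable_on (UNIV - {(0, 0)})"
    by (rule summable_on_cmult_right)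
  hence "(\<lambda>p. norm (1 / norm (lattice_point \<tau> p) ^ 3)) summable_on (UNIV - {(0, 0)})"
  proof (rule Infinite_Sum.abs_summable_on_comparison_test')
    fix p :: "int \<times> int" assume p: "p \<in> UNIV - {(0, 0)}"
    obtain m n where mn: "p = (m, n)" by force
    define A where "A = (1 + real (nat \<bar>m\<bar>)) * (1 + real (nat \<bar>n\<bar>))"
    define N where "N = norm (lattice_point \<tau> p)"
    have N: "N > 0" using p by (simp add: N_def lattice_point_0_iff)
    have "\<bar>m\<bar> + \<bar>n\<bar> \<ge> 1" using p mn by auto
    hence ge: "\<bar>real_of_int m\<bar> + \<bar>real_of_int n\<bar> \<ge> 1" by linarith
    have "A \<le> (1 + (\<bar>real_of_int m\<bar> + \<bar>real_of_int n\<bar>)) * (1 + (\<bar>real_of_int m\<bar> + \<bar>real_of_int n\<bar>))"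
      unfolding A_def by (intro mult_mono) auto
    also have "\<dots> \<le> (2 * (\<bar>real_of_int m\<bar> + \<bar>real_of_int n\<bar>)) * (2 * (\<bar>real_of_int m\<bar> + \<bar>real_of_int n\<bar>))"
      using ge by (intro mult_mono) auto
    also have "\<dots> \<le> (2 * (K * N)) * (2 * (K * N))"
      using K(2)[of m n] K(1) N unfolding N_def lattice_point_def mn
      by (intro mult_mono) auto
    finally have "A \<le> (2 * K * N)\<^sup>2" by (simp add: power2_eq_square mult_ac)
    moreover have "A > 0" by (simp add: A_def)
    ultimately have "A powr (3/2) \<le> ((2 * K * N)\<^sup>2) powr (3/2)" by (intro powr_mono2) auto
    also have "\<dots> = (2 * K * N) powr 3"
      using K N by (simp add: powr_powr flip: powr_numeral)
    also have "\<dots> = (2 * K) ^ 3 * N ^ 3" using K N by (simp add: powr_numeral power_mult_distrib)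
    finally have "1 / N ^ 3 \<le> (2 * K) ^ 3 * (1 / A powr (3/2))"
      using N \<open>A > 0\<close> by (simp add: field_simps)
    also have "1 / A powr (3/2) = A powr (- (3/2))" by (rule powr_minus_divide[symmetric])
    also have "\<dots> = g m * g n" unfolding A_def g_def by (rule powr_mult)
    finally show "norm (1 / norm (lattice_point \<tau> p) ^ 3) \<le> (2 * K) ^ 3 * (case p of (m, n) \<Rightarrow> g m * g n)"
      using N by (simp add: N_def mn)
  qed
  thus ?thesis by simp
qed

lemma lattice_distance_ge:
  assumes z0: "z0 \<notin> period_lattice \<tau> - {0}"
  obtains r c where "r > 0" "c > 0"
    "\<And>z l. z \<in> cball z0 r \<Longrightarrow> l \<in> period_lattice \<tau> \<Longrightarrow> l \<noteq> 0 \<Longrightarrow> norm (z - l) \<ge> c * norm l"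
proof -
  have "open (- (period_lattice \<tau> - {0}))"
    using closed_subset_lattice[OF tau, of "period_lattice \<tau> - {0}"] open_Compl by blast
  then obtain d where d: "d > 0" "ball z0 d \<subseteq> - (period_lattice \<tau> - {0})"
    using z0 by (metis Compl_iff open_contains_ball)
  define R where "R = norm z0 + d / 2"
  show ?thesis
  proof (rule that)
    show "d / 2 > 0" "1 / (1 + R / (d / 2)) > 0"
      using d by (simp_all add: R_def add_pos_nonneg)
    fix z l assume z: "z \<in> cball z0 (d / 2)" and l: "l \<in> period_lattice \<tau>" "l \<noteq> 0"
    have "l \<notin> ball z0 d" using d l by auto
    hence "d \<le> norm (z0 - l)" by (simp add: dist_norm)
    also have "\<dots> \<le> norm (z0 - z) + norm (z - l)" using norm_triangle_ineq[of "z0 - z" "z - l"] by simp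
    finally have 1: "d / 2 \<le> norm (z - l)" using z by (simp add: dist_norm)
    have "norm z \<le> norm z0 + norm (z - z0)" using norm_triangle_ineq[of z0 "z - z0"] by simp
    hence R: "norm z \<le> R" using z by (simp add: R_def dist_norm norm_minus_commute)
    have "norm l \<le> norm (z - l) + norm z" using norm_triangle_ineq4[of z "z - l"] by simp
    also have "\<dots> \<le> norm (z - l) + R * 1" using R by simp
    also have "\<dots> \<le> norm (z - l) + R * (norm (z - l) / (d / 2))"
      using 1 d by (intro add_mono mult_left_mono) (auto simp: R_def field_simps)
    also have "\<dots> = (1 + R / (d / 2)) * norm (z - l)" by (simp add: algebra_simps)
    finally show "1 / (1 + R / (d / 2)) * norm l \<le> norm (z - l)"
      using d by (simp add: R_def field_simps add_pos_nonneg)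
  qed
qed

text \<open>The derivative is recorded as a sum because the differentiated terms, free of the
  correction 1 / l^2, are permuted by lattice translations; periodicity is drawn from this.\<close>

lemma wp_regular_derivative:
  assumes z0: "z0 \<notin> period_lattice \<tau> - {0}"
  shows "\<exists>D. (wp_regular \<tau> has_field_derivative D) (at z0) \<and>
      ((\<lambda>p. - 2 / (z0 - lattice_point \<tau> p) ^ 3) has_sum D) (UNIV - {(0, 0)})"
proof -
  obtain r c where r: "r > 0" and c: "c > 0" and ge:
    "\<And>z l. z \<in> cball z0 r \<Longrightarrow> l \<in> period_lattice \<tau> \<Longrightarrow> l \<noteq> 0 \<Longrightarrow> norm (z - l) \<ge> c * norm l"
    using lattice_distance_ge[OF z0] by blast
  obtain e where e: "e > 0" "\<And>l. l \<in> period_lattice \<tau> \<Longrightarrow> l \<noteq> 0 \<Longrightarrow> norm l \<ge> e"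
    using lattice_separated[OF tau] by blast
  let ?A = "UNIV - {(0 :: int, 0 :: int)}"
  define R where "R = norm z0 + r"
  \<comment> \<open>Over a common denominator a term equals z (2 l - z) / ((z - l)^2 l^2). With |z|
    \<le> R, |z - l| \<ge> c |l| and R \<le> (R / e) |l| its norm is at most C / |l|^3.\<close>
  define C where "C = R * (2 + R / e) / c\<^sup>2"
  let ?f = "\<lambda>p z. 1 / (z - lattice_point \<tau> p)\<^sup>2 - 1 / (lattice_point \<tau> p)\<^sup>2"
  have "uniform_limit (cball z0 r) (\<lambda>X z. \<Sum>p\<in>X. ?f p z)
      (\<lambda>z. \<Sum>\<^sub>\<infinity>p\<in>?A. ?f p z) (finite_subsets_at_top ?A)"
  proof (rule Weierstrass_m_test_general)
    show "(\<lambda>p. C * (1 / norm (lattice_point \<tau> p) ^ 3)) summable_on ?A"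
      by (intro summable_on_cmult_right summable_lattice_cubes)
    fix p z assume p: "p \<in> ?A" and z: "z \<in> cball z0 r"
    define l where "l = lattice_point \<tau> p"
    have l: "l \<in> period_lattice \<tau>" "l \<noteq> 0" using p by (auto simp: l_def lattice_point_0_iff)
    have zl: "norm (z - l) \<ge> c * norm l" using ge z l by blast
    have pos: "c * norm l > 0" using c l by simp
    have "norm z \<le> norm z0 + norm (z - z0)" using norm_triangle_ineq[of z0 "z - z0"] by simp
    hence R: "norm z \<le> R" using z by (simp add: R_def dist_norm norm_minus_commute)
    hence R0: "R \<ge> 0" using norm_ge_zero order_trans by blast
    have "R = R / e * e" using e by simp
    also have "\<dots> \<le> R / e * norm l" using e l R0 by (intro mult_left_mono) auto
    finally have Rl: "R \<le> R / e * norm l" .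
    have "z - l \<noteq> 0" using zl pos by auto
    hence "?f p z = (l\<^sup>2 - (z - l)\<^sup>2) / ((z - l)\<^sup>2 * l\<^sup>2)"
      using l by (simp add: l_def[symmetric] diff_frac_eq)
    also have "l\<^sup>2 - (z - l)\<^sup>2 = z * (2 * l - z)" by (simp add: power2_eq_square algebra_simps)
    finally have "?f p z = z * (2 * l - z) / ((z - l)\<^sup>2 * l\<^sup>2)" .
    hence "norm (?f p z) = norm z * norm (2 * l - z) / (norm (z - l) ^ 2 * norm l ^ 2)"
      by (simp add: norm_mult norm_divide norm_power)
    also have "\<dots> \<le> R * (2 * norm l + R) / ((c * norm l) ^ 2 * norm l ^ 2)"
    proof (intro frac_le mult_mono power_mono)
      show "norm (2 * l - z) \<le> 2 * norm l + R"
        using norm_triangle_ineq4[of "2 * l" z] R by (simp add: norm_mult)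
      show "0 < (c * norm l)\<^sup>2 * (norm l)\<^sup>2"
        by (intro mult_pos_pos zero_less_power pos) (use l in simp)
    qed (use R R0 zl pos l in auto)
    also have "\<dots> \<le> R * (2 * norm l + R / e * norm l) / ((c * norm l) ^ 2 * norm l ^ 2)"
      using R0 Rl by (intro divide_right_mono mult_left_mono add_left_mono) auto
    also have "\<dots> = C * (1 / norm l ^ 3)"
      using l c by (simp add: C_def field_simps power2_eq_square power3_eq_cube)
    finally show "norm (?f p z) \<le> C * (1 / norm (lattice_point \<tau> p) ^ 3)" by (simp only: l_def)
  qed
  hence ulim: "uniform_limit (cball z0 r) (\<lambda>X z. \<Sum>p\<in>X. ?f p z) (wp_regular \<tau>) (finite_subsets_at_top ?A)"
    by (simp add: wp_regular_def[abs_def])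
  have nz: "z - lattice_point \<tau> p \<noteq> 0" if "z \<in> cball z0 r" "p \<in> ?A" for z p
  proof -
    have "lattice_point \<tau> p \<noteq> 0" using that by (auto simp: lattice_point_0_iff)
    hence "c * norm (lattice_point \<tau> p) > 0" using c by simp
    also have "\<dots> \<le> norm (z - lattice_point \<tau> p)" using that \<open>lattice_point \<tau> p \<noteq> 0\<close> by (intro ge) auto
    finally show ?thesis by auto
  qed
  have ev: "\<forall>\<^sub>F X in finite_subsets_at_top ?A. continuous_on (cball z0 r) (\<lambda>z. \<Sum>p\<in>X. ?f p z) \<and>
      (\<forall>w\<in>ball z0 r. ((\<lambda>z. \<Sum>p\<in>X. ?f p z) has_field_derivative
        (\<Sum>p\<in>X. - 2 / (w - lattice_point \<tau> p) ^ 3)) (at w))"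
  proof (rule eventually_finite_subsets_at_top_weakI)
    fix X assume "finite X" and X: "X \<subseteq> ?A"
    have cont: "continuous_on (cball z0 r) (\<lambda>z. \<Sum>p\<in>X. ?f p z)"
      using nz X by (intro continuous_intros ballI) (metis power_not_zero subsetD)
    have "((\<lambda>z. ?f p z) has_field_derivative - 2 / (w - lattice_point \<tau> p) ^ 3) (at w)"
      if "w \<in> ball z0 r" "p \<in> X" for w p
    proof -
      have "w - lattice_point \<tau> p \<noteq> 0" using nz[of w p] that X by auto
      thus ?thesis
        using DERIV_diff[OF DERIV_inverse_square[of w "lattice_point \<tau> p"] DERIV_const] by simp
    qed
    with cont show "continuous_on (cball z0 r) (\<lambda>z. \<Sum>p\<in>X. ?f p z) \<and>
      (\<forall>w\<in>ball z0 r. ((\<lambda>z. \<Sum>p\<in>X. ?f p z) has_field_derivative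
        (\<Sum>p\<in>X. - 2 / (w - lattice_point \<tau> p) ^ 3)) (at w))"
      by (intro conjI ballI DERIV_sum)
  qed
  obtain g' where "\<And>w. w \<in> ball z0 r \<Longrightarrow> (wp_regular \<tau> has_field_derivative g' w) (at w) \<and>
      ((\<lambda>X. \<Sum>p\<in>X. - 2 / (w - lattice_point \<tau> p) ^ 3) \<longlongrightarrow> g' w) (finite_subsets_at_top ?A)"
    using has_complex_derivative_uniform_limit[OF ev ulim _ r] by auto
  thus ?thesis using r unfolding has_sum_def by (metis centre_in_ball)
qed

lemma wp_regular_holomorphic: "wp_regular \<tau> holomorphic_on - (period_lattice \<tau> - {0})"
  unfolding holomorphic_on_def field_differentiable_def
  using wp_regular_derivative has_field_derivative_at_within by blast

text \<open>The pole at 0 contributes -2 / z^3, which is exactly the missing index (0, 0), so the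
  sum runs over the full lattice.\<close>

lemma weierstrass_p_derivative:
  assumes z: "z \<notin> period_lattice \<tau>"
  shows "(weierstrass_p \<tau> has_field_derivative (\<Sum>\<^sub>\<infinity>p. - 2 / (z - lattice_point \<tau> p) ^ 3)) (at z)"
proof -
  obtain D where D: "(wp_regular \<tau> has_field_derivative D) (at z)"
      "((\<lambda>p. - 2 / (z - lattice_point \<tau> p) ^ 3) has_sum D) (UNIV - {(0, 0)})"
    using wp_regular_derivative[of z] z by blast
  have "z \<noteq> 0" using z by auto
  have "((\<lambda>p. - 2 / (z - lattice_point \<tau> p) ^ 3) has_sum (- 2 / (z - lattice_point \<tau> (0, 0)) ^ 3 + D))
      (insert (0, 0) (UNIV - {(0, 0)}))"
    by (rule has_sum_insert[OF _ D(2)]) auto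
  hence "((\<lambda>p. - 2 / (z - lattice_point \<tau> p) ^ 3) has_sum (- 2 / z ^ 3 + D)) UNIV"
    by (simp add: lattice_point_def)
  hence "(\<Sum>\<^sub>\<infinity>p. - 2 / (z - lattice_point \<tau> p) ^ 3) = - 2 / z ^ 3 + D" by (rule infsumI)
  moreover have "((\<lambda>z. 1 / z\<^sup>2 + wp_regular \<tau> z) has_field_derivative - 2 / z ^ 3 + D) (at z)"
    using \<open>z \<noteq> 0\<close> D(1)
    by (auto intro!: derivative_eq_intros simp: field_simps power2_eq_square power3_eq_cube)
  ultimately show ?thesis by (simp add: weierstrass_p_eq[abs_def])
qed

text \<open>Reindexing shows that the derivative is periodic, so the difference of the two sides is
  constant; at -l/2 evenness makes it 0. The condition on \<open>l / 2\<close> keeps this point away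
  from the poles.\<close>

lemma weierstrass_p_periodic:
  assumes l: "l \<in> period_lattice \<tau>" "l / 2 \<notin> period_lattice \<tau>" and z: "z \<notin> period_lattice \<tau>"
  shows "weierstrass_p \<tau> (z + l) = weierstrass_p \<tau> z"
proof -
  let ?D = "\<lambda>z. \<Sum>\<^sub>\<infinity>p. - 2 / (z - lattice_point \<tau> p) ^ 3"
  let ?g = "\<lambda>z. weierstrass_p \<tau> (z + l) - weierstrass_p \<tau> z"
  obtain q where q: "l = lattice_point \<tau> q" using l lattice_pointE by blast
  have D_per: "?D (z + l) = ?D z" for z
    by (rule infsum_reindex_bij_witness[of _ "\<lambda>p. p + q" "\<lambda>p. p - q"])
       (auto simp: q lattice_point_add lattice_point_def algebra_simps)
  have der: "(?g has_field_derivative 0) (at z)" if "z \<notin> period_lattice \<tau>" for z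
  proof -
    have "z + l \<notin> period_lattice \<tau>" using that l by (simp add: period_lattice_add_iff)
    hence "((\<lambda>z. weierstrass_p \<tau> (z + l)) has_field_derivative ?D (z + l) * 1) (at z)"
      by (intro DERIV_chain2[OF weierstrass_p_derivative]) (auto intro!: derivative_eq_intros)
    from DERIV_diff[OF this weierstrass_p_derivative[OF that]] show ?thesis
      by (simp only: D_per mult_1_right diff_self)
  qed
  have "?g constant_on - period_lattice \<tau>"
    using der by (intro has_field_derivative_0_imp_constant_on connected_Compl_period_lattice
        open_Compl_lattice[OF tau]) auto
  then obtain C where C: "\<And>z. z \<notin> period_lattice \<tau> \<Longrightarrow> ?g z = C"
    by (auto simp: constant_on_def)
  have "- l / 2 \<notin> period_lattice \<tau>" using l period_lattice_minus_iff[of "l / 2"] by simp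
  hence "C = weierstrass_p \<tau> (- l / 2 + l) - weierstrass_p \<tau> (- l / 2)" using C by metis
  also have "- l / 2 + l = - (- l / 2)" by simp
  also have "weierstrass_p \<tau> \<dots> - weierstrass_p \<tau> (- l / 2) = 0"
    by (simp only: weierstrass_p_minus) simp
  finally show ?thesis using C[OF z] by simp
qed

lemma weierstrass_p_add_1: "z \<notin> period_lattice \<tau> \<Longrightarrow> weierstrass_p \<tau> (z + 1) = weierstrass_p \<tau> z"
  using half_lattice_iff[of 1 0] by (intro weierstrass_p_periodic) auto

lemma weierstrass_p_add_tau: "z \<notin> period_lattice \<tau> \<Longrightarrow> weierstrass_p \<tau> (z + \<tau>) = weierstrass_p \<tau> z"
  using half_lattice_iff[of 0 1] by (intro weierstrass_p_periodic) auto

end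

subsection \<open>The functions \<open>phi\<close>\<close>

lemma omega_simps [simp]:
  "omega \<tau> $ 1 = 1 / 2" "omega \<tau> $ 2 = \<tau> / 2" "omega \<tau> $ 3 = (1 + \<tau>) / 2"
  by (simp_all add: omega_def vector_3)

lemma d_omega_simps [simp]:
  "d_omega \<tau> $ 1 = 0" "d_omega \<tau> $ 2 = 1 / 2" "d_omega \<tau> $ 3 = 1 / 2"
proof -
  show "d_omega \<tau> $ 1 = 0" by (simp add: d_omega_def)
  show "d_omega \<tau> $ 2 = 1 / 2" unfolding d_omega_def vec_lambda_beta omega_simps
    by (intro DERIV_imp_deriv) (auto intro!: derivative_eq_intros)
  show "d_omega \<tau> $ 3 = 1 / 2" unfolding d_omega_def vec_lambda_beta omega_simps
    by (intro DERIV_imp_deriv) (auto intro!: derivative_eq_intros)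
qed

lemma phi_eq: "phi \<tau> \<alpha> z = exp (2 * pi * \<i> * z * d_omega \<tau> $ \<alpha>) *
    (theta \<tau> (z + omega \<tau> $ \<alpha>) * deriv (theta \<tau>) 0 / (theta \<tau> z * theta \<tau> (omega \<tau> $ \<alpha>)))"
  by (simp add: phi_def kronecker_phi_def)

text \<open>With \<open>phi_mult_tau\<close> these are the three nontrivial sign characters of the
  lattice modulo its double: (1, -1), (-1, 1), (-1, -1). Two facts matter later: the product of two
  of them is the third, and none is trivial.\<close>

definition phi_mult_1 :: "3 \<Rightarrow> complex" where
  "phi_mult_1 \<alpha> = (if \<alpha> = 1 then 1 else - 1)"

definition phi_mult_tau :: "3 \<Rightarrow> complex" where
  "phi_mult_tau \<alpha> = (if \<alpha> = 2 then 1 else - 1)"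

lemma two_omega:
  "2 * omega \<tau> $ 1 = 1" "2 * omega \<tau> $ 2 = \<tau>" "2 * omega \<tau> $ 3 = 1 + \<tau>"
  by (simp_all add: field_simps)

lemma two_omega_in_lattice: "2 * omega \<tau> $ \<alpha> \<in> period_lattice \<tau>"
  using exhaust_3[of \<alpha>] period_lattice_add[OF one_in_period_lattice tau_in_period_lattice]
  by (elim disjE) (simp_all only: two_omega one_in_period_lattice tau_in_period_lattice)

lemma theta_two_omega: "theta \<tau> (2 * omega \<tau> $ \<alpha>) = 0"
  using exhaust_3[of \<alpha>] by (elim disjE) (simp_all only: two_omega theta_half_periods)

text \<open>Quasi-periodicity for the period 2 \<omega>_\<alpha>, centred at z, where the constant
  part of the exponent reduces to a sign. Parity of \<open>phi\<close>, the value of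
  \<open>E1\<close> at \<omega>_\<alpha> and the formula with \<nu>' are all read off from
  it.\<close>

lemma theta_half_shift:
  "theta \<tau> (z + omega \<tau> $ \<alpha>) = - exp (- 4 * pi * \<i> * d_omega \<tau> $ \<alpha> * z) * theta \<tau> (z - omega \<tau> $ \<alpha>)"
proof -
  have "theta \<tau> (z + 1/2) = - theta \<tau> (z - 1/2)"
    using theta_add_1[of \<tau> "z - 1/2"] by (simp add: add.commute)
  moreover have "theta \<tau> (z + \<tau>/2) = - exp (- 2 * pi * \<i> * z) * theta \<tau> (z - \<tau>/2)"
    using theta_add_tau[of \<tau> "z - \<tau>/2"] by (simp add: algebra_simps)
  moreover have "theta \<tau> (z + (1 + \<tau>)/2) = - exp (- 2 * pi * \<i> * z) * theta \<tau> (z - (1 + \<tau>)/2)"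
  proof -
    define u where "u = z - (1 + \<tau>)/2"
    have "theta \<tau> (z + (1 + \<tau>)/2) = theta \<tau> (u + \<tau> + 1)" by (simp add: u_def field_simps)
    also have "\<dots> = exp (- pi * \<i> * \<tau> - 2 * pi * \<i> * u) * theta \<tau> u"
      by (simp add: theta_add_1 theta_add_tau)
    also have "- pi * \<i> * \<tau> - 2 * pi * \<i> * u = - 2 * pi * \<i> * z + pi * \<i>"
      by (simp add: u_def field_simps)
    finally show ?thesis by (simp only: exp_add exp_pi_i u_def) simp
  qed
  ultimately show ?thesis using exhaust_3[of \<alpha>] by (auto simp: mult_ac)
qed

text \<open>Replacing z by -z changes the exponential prefactor by exactly the exponential in
  \<open>theta_half_shift\<close>. The two signs from the oddness of \<open>theta\<close> cancel,
  and the sign of the half-period shift remains.\<close>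

lemma phi_minus: "phi \<tau> \<alpha> (- z) = - phi \<tau> \<alpha> z"
proof -
  let ?w = "omega \<tau> $ \<alpha>" and ?d = "d_omega \<tau> $ \<alpha>"
  have "theta \<tau> (- z + ?w) = - theta \<tau> (z - ?w)"
    using theta_minus[of \<tau> "z - ?w"] by simp
  hence "phi \<tau> \<alpha> (- z) = exp (- (2 * pi * \<i> * z * ?d)) *
      (theta \<tau> (z - ?w) * deriv (theta \<tau>) 0 / (theta \<tau> z * theta \<tau> ?w))"
    by (simp add: phi_eq theta_minus)
  moreover have "exp (2 * pi * \<i> * z * ?d) * exp (- 4 * pi * \<i> * ?d * z) = exp (- (2 * pi * \<i> * z * ?d))"
    unfolding exp_add[symmetric] by (rule arg_cong[of _ _ exp]) (simp add: algebra_simps)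
  ultimately show ?thesis by (simp add: phi_eq theta_half_shift)
qed

lemma phi_add_1: "phi \<tau> \<alpha> (z + 1) = phi_mult_1 \<alpha> * phi \<tau> \<alpha> z"
proof -
  let ?w = "omega \<tau> $ \<alpha>" and ?d = "d_omega \<tau> $ \<alpha>"
  have "theta \<tau> (z + 1 + ?w) = - theta \<tau> (z + ?w)"
    using theta_add_1[of \<tau> "z + ?w"] by (simp add: add_ac)
  hence "phi \<tau> \<alpha> (z + 1) = exp (2 * pi * \<i> * ?d) * phi \<tau> \<alpha> z"
    by (simp add: phi_eq theta_add_1 ring_distribs exp_add)
  moreover have "exp (2 * pi * \<i> * ?d) = phi_mult_1 \<alpha>"
    using exhaust_3[of \<alpha>] by (auto simp: phi_mult_1_def)
  ultimately show ?thesis by simp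
qed

lemma phi_add_tau: "phi \<tau> \<alpha> (z + \<tau>) = phi_mult_tau \<alpha> * phi \<tau> \<alpha> z"
proof -
  let ?w = "omega \<tau> $ \<alpha>" and ?d = "d_omega \<tau> $ \<alpha>" and ?c = "exp (- pi * \<i> * \<tau> - 2 * pi * \<i> * z)"
  have "theta \<tau> (z + \<tau> + ?w) = - exp (- pi * \<i> * \<tau> - 2 * pi * \<i> * (z + ?w)) * theta \<tau> (z + ?w)"
    using theta_add_tau[of \<tau> "z + ?w"] by (simp add: add_ac)
  also have "exp (- pi * \<i> * \<tau> - 2 * pi * \<i> * (z + ?w)) = ?c * exp (- 2 * pi * \<i> * ?w)"
    unfolding exp_add[symmetric] by (rule arg_cong[of _ _ exp]) (simp add: algebra_simps)
  finally have 1: "theta \<tau> (z + \<tau> + ?w) = - ?c * (exp (- 2 * pi * \<i> * ?w) * theta \<tau> (z + ?w))" by simp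
  have 2: "theta \<tau> (z + \<tau>) = - ?c * theta \<tau> z" by (rule theta_add_tau)
  have 3: "exp (2 * pi * \<i> * (z + \<tau>) * ?d) = exp (2 * pi * \<i> * z * ?d) * exp (2 * pi * \<i> * \<tau> * ?d)"
    unfolding exp_add[symmetric] by (rule arg_cong[of _ _ exp]) (simp add: algebra_simps)
  \<comment> \<open>The factor depending on z cancels between numerator and denominator. The
    prefactor of \<open>phi\<close> removes \<tau> from the remaining exponent 2 pi i (\<tau>
    \<open>?d\<close> - \<open>?w\<close>), which leaves a sign.\<close>
  have "phi \<tau> \<alpha> (z + \<tau>) = exp (2 * pi * \<i> * \<tau> * ?d) * exp (- 2 * pi * \<i> * ?w) * phi \<tau> \<alpha> z"
    unfolding phi_eq 1 2 3 by simp
  also have "exp (2 * pi * \<i> * \<tau> * ?d) * exp (- 2 * pi * \<i> * ?w) = exp (2 * pi * \<i> * \<tau> * ?d - 2 * pi * \<i> * ?w)"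
    by (simp add: exp_diff exp_minus divide_inverse)
  also have "\<dots> = phi_mult_tau \<alpha>"
    using exhaust_3[of \<alpha>] by (auto simp: phi_mult_tau_def exp_minus field_simps)
  finally show ?thesis .
qed

lemma phi_mult_third:
  assumes "\<alpha> \<noteq> \<beta>" "\<beta> \<noteq> \<gamma>" "\<alpha> \<noteq> \<gamma>"
  shows "phi_mult_1 \<beta> * phi_mult_1 \<gamma> = phi_mult_1 \<alpha>"
    "phi_mult_tau \<beta> * phi_mult_tau \<gamma> = phi_mult_tau \<alpha>"
  using assms exhaust_3[of \<alpha>] exhaust_3[of \<beta>] exhaust_3[of \<gamma>]
  by (auto simp: phi_mult_1_def phi_mult_tau_def)

lemma phi_omega: "phi \<tau> \<alpha> (omega \<tau> $ \<alpha>) = 0"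
  using theta_two_omega[of \<tau> \<alpha>] by (simp add: phi_eq flip: mult_2)

lemma spectral_domain_notin:
  assumes "z \<in> spectral_domain \<tau>"
  shows "z \<notin> period_lattice \<tau>" "z + omega \<tau> $ \<alpha> \<notin> period_lattice \<tau>"
    "z - omega \<tau> $ \<alpha> \<notin> period_lattice \<tau>"
proof -
  have *: "w \<notin> period_lattice \<tau>" if "2 * w = 2 * z + l" "l \<in> period_lattice \<tau>" for w l
  proof
    assume "w \<in> period_lattice \<tau>"
    hence "2 * w \<in> period_lattice \<tau>" unfolding mult_2 by (intro period_lattice_add)
    hence "2 * z \<in> period_lattice \<tau>" unfolding that(1) period_lattice_add_iff[OF that(2)] .
    thus False using assms by (simp add: spectral_domain_def)
  qed
  show "z \<notin> period_lattice \<tau>" by (rule *[of _ 0]) auto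
  show "z + omega \<tau> $ \<alpha> \<notin> period_lattice \<tau>"
    by (rule *[of _ "2 * omega \<tau> $ \<alpha>"]) (auto simp: two_omega_in_lattice)
  show "z - omega \<tau> $ \<alpha> \<notin> period_lattice \<tau>"
    by (rule *[of _ "- (2 * omega \<tau> $ \<alpha>)"]) (auto simp: two_omega_in_lattice)
qed

section \<open>Expansion of phi at the origin and the identities it implies\<close>

context
  fixes \<tau> :: complex
  assumes tau: "Im \<tau> > 0"
begin

lemmas theta_nz = theta_zeros[OF tau]

lemma omega_notin_lattice: "omega \<tau> $ \<alpha> \<notin> period_lattice \<tau>"
  using half_lattice_iff[OF tau, of 1 0] half_lattice_iff[OF tau, of 0 1]
    half_lattice_iff[OF tau, of 1 1] exhaust_3[of \<alpha>] by auto

lemma theta_omega: "theta \<tau> (omega \<tau> $ \<alpha>) \<noteq> 0"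
  by (intro theta_nz omega_notin_lattice)

lemma phi_nonzero:
  assumes "z \<in> spectral_domain \<tau>"
  shows "phi \<tau> \<alpha> z \<noteq> 0"
  using spectral_domain_notin[OF assms] theta_nz theta_omega deriv_theta_0[OF tau]
  by (simp add: phi_eq)

lemma phi_holomorphic: "phi \<tau> \<alpha> holomorphic_on - period_lattice \<tau>"
  unfolding phi_eq[abs_def] using theta_nz theta_omega
  by (intro holomorphic_intros theta_holomorphic'[OF tau]) auto

lemma phi_has_field_derivative:
  "z \<notin> period_lattice \<tau> \<Longrightarrow> (phi \<tau> \<alpha> has_field_derivative deriv (phi \<tau> \<alpha>) z) (at z)"
  by (rule holomorphic_derivI[OF phi_holomorphic open_Compl_lattice[OF tau]]) auto

text \<open>The residue 1 comes from the normalisation by the derivative of \<open>theta\<close> at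
  0. The value \<open>g 0\<close> = 0 expresses oddness; as phi = 1/z + g holds only for z \<noteq>
  0, it is reached through limits.\<close>

lemma phi_expansion:
  "\<exists>r g. r > 0 \<and> g holomorphic_on ball 0 r \<and> g 0 = 0 \<and>
    (\<forall>z\<in>ball 0 r - {0}. phi \<tau> \<alpha> z = 1 / z + g z)"
proof -
  obtain e where e: "e > 0" "\<And>l. l \<in> period_lattice \<tau> \<Longrightarrow> l \<noteq> 0 \<Longrightarrow> norm l \<ge> e"
    using lattice_separated[OF tau] by blast
  let ?w = "omega \<tau> $ \<alpha>" and ?d = "d_omega \<tau> $ \<alpha>"
  \<comment> \<open>Here t is \<open>theta\<close> divided by z, \<psi> is z times
    \<open>phi\<close>, and g is the difference quotient of \<psi> at 0. Filling in the derivative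
    at 0 is what makes t and g holomorphic by \<open>pole_lemma_open\<close>.\<close>
  define t where "t = (\<lambda>z. if z = 0 then deriv (theta \<tau>) 0 else (theta \<tau> z - theta \<tau> 0) / (z - 0))"
  define \<psi> where "\<psi> = (\<lambda>z. exp (2 * pi * \<i> * z * ?d) *
      (theta \<tau> (z + ?w) * deriv (theta \<tau>) 0 / (t z * theta \<tau> ?w)))"
  define g where "g = (\<lambda>z. if z = 0 then deriv \<psi> 0 else (\<psi> z - \<psi> 0) / (z - 0))"
  have "t holomorphic_on UNIV"
    unfolding t_def by (rule pole_lemma_open[OF theta_holomorphic[OF tau]]) auto
  hence t_hol: "t holomorphic_on ball 0 e" by (rule holomorphic_on_subset) auto
  have notin: "z \<notin> period_lattice \<tau>" if "z \<in> ball 0 e" "z \<noteq> 0" for z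
    using e(2)[of z] that by auto
  have t_nz: "t z \<noteq> 0" if "z \<in> ball 0 e" for z
    using that notin theta_nz deriv_theta_0[OF tau] by (auto simp: t_def)
  have "\<psi> holomorphic_on ball 0 e"
    unfolding \<psi>_def using t_nz theta_omega
    by (intro holomorphic_intros theta_holomorphic'[OF tau] t_hol) auto
  hence g_hol: "g holomorphic_on ball 0 e"
    unfolding g_def by (rule pole_lemma_open) auto
  have psi0: "\<psi> 0 = 1"
    using theta_omega deriv_theta_0[OF tau] by (simp add: \<psi>_def t_def)
  have eq: "phi \<tau> \<alpha> z = 1 / z + g z" if "z \<in> ball 0 e" "z \<noteq> 0" for z
  proof -
    have "phi \<tau> \<alpha> z = \<psi> z / z"
      using that by (simp add: phi_eq \<psi>_def t_def)
    also have "\<dots> = 1 / z + g z" using that by (simp add: g_def psi0 diff_divide_distrib)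
    finally show ?thesis .
  qed
  have "isCont g 0"
    using holomorphic_on_imp_continuous_on[OF g_hol] e(1)
    by (simp add: continuous_on_eq_continuous_at)
  hence lim: "(g \<longlongrightarrow> g 0) (at 0)" by (simp add: isCont_def)
  have "((\<lambda>z. g (- z)) \<longlongrightarrow> g 0) (at 0)"
  proof -
    have "isCont (\<lambda>z. g (- z)) 0"
      by (rule isCont_o2[where g = g]) (use \<open>isCont g 0\<close> in \<open>auto intro: continuous_intros\<close>)
    thus ?thesis by (simp add: isCont_def)
  qed
  moreover have "\<forall>\<^sub>F z in at 0. g (- z) = - g z"
  proof -
    have "\<forall>\<^sub>F z in at 0. z \<in> ball 0 e - {0}"
      using e(1) by (intro eventually_at_in_open) auto
    thus ?thesis
    proof eventually_elim
      case (elim z)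
      thus ?case using eq[of z] eq[of "- z"] phi_minus[of \<tau> \<alpha> z] by simp
    qed
  qed
  ultimately have "((\<lambda>z. - g z) \<longlongrightarrow> g 0) (at 0)" by (rule Lim_transform_eventually)
  hence "g 0 = - g 0" using tendsto_minus[OF lim] tendsto_unique by (metis at_neq_bot)
  hence "g 0 = 0" by simp
  thus ?thesis using e(1) g_hol eq by blast
qed

lemma phi_square:
  assumes "z \<notin> period_lattice \<tau>"
  shows "(phi \<tau> \<alpha> z)\<^sup>2 = weierstrass_p \<tau> z - weierstrass_p \<tau> (omega \<tau> $ \<alpha>)"
proof -
  define h where "h = (\<lambda>z. (phi \<tau> \<alpha> z)\<^sup>2 - weierstrass_p \<tau> z)"
  obtain r g where g: "r > 0" "g holomorphic_on ball 0 r" "g 0 = 0"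
    "\<forall>z\<in>ball 0 r - {0}. phi \<tau> \<alpha> z = 1 / z + g z"
    using phi_expansion[of \<alpha>] by blast
  have der: "(g has_field_derivative deriv g 0) (at 0)"
    using g by (intro holomorphic_derivI[of g "ball 0 r"]) auto
  have lim_q: "((\<lambda>z. g z / z) \<longlongrightarrow> deriv g 0) (at 0)" using der g(3) by (simp add: DERIV_def)
  have lim_g: "(g \<longlongrightarrow> 0) (at 0)" using DERIV_isCont[OF der] g(3) by (simp add: isCont_def)
  obtain D where "(wp_regular \<tau> has_field_derivative D) (at 0)"
    using wp_regular_derivative[OF tau, of 0] by auto
  hence lim_w: "(wp_regular \<tau> \<longlongrightarrow> 0) (at 0)"
    using DERIV_isCont wp_regular_0[of \<tau>] by (fastforce simp: isCont_def)
  \<comment> \<open>This is (1/z + g)^2 - 1/z^2 - \<open>wp_regular\<close>; the mixed term has a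
    limit because g vanishes at 0.\<close>
  have "((\<lambda>z. 2 * (g z / z) + (g z)\<^sup>2 - wp_regular \<tau> z) \<longlongrightarrow> 2 * deriv g 0 + 0\<^sup>2 - 0) (at 0)"
    by (intro tendsto_intros lim_q lim_g lim_w)
  moreover have "\<forall>\<^sub>F z in at 0. 2 * (g z / z) + (g z)\<^sup>2 - wp_regular \<tau> z = h z"
  proof -
    have "\<forall>\<^sub>F z in at 0. z \<in> ball 0 r - {0}"
      using g(1) by (intro eventually_at_in_open) auto
    thus ?thesis
    proof eventually_elim
      case (elim z)
      thus ?case
        by (simp add: h_def g(4) weierstrass_p_eq power2_sum power_divide)
    qed
  qed
  ultimately have "(h \<longlongrightarrow> 2 * deriv g 0 + 0\<^sup>2 - 0) (at 0)"
    by (rule Lim_transform_eventually)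
  then obtain C where C: "\<And>z. z \<notin> period_lattice \<tau> \<Longrightarrow> h z = C"
  proof (rule elliptic_constant[OF tau, rotated 5])
    have "wp_regular \<tau> holomorphic_on - period_lattice \<tau>"
      using wp_regular_holomorphic[OF tau] by (rule holomorphic_on_subset) auto
    thus "h holomorphic_on - period_lattice \<tau>"
      unfolding h_def weierstrass_p_eq by (intro holomorphic_intros phi_holomorphic) auto
    show "h (z + 1) = 1 * h z" if "z \<notin> period_lattice \<tau>" for z
      using that by (simp add: h_def phi_add_1 phi_mult_1_def weierstrass_p_add_1[OF tau] power_mult_distrib)
    show "h (z + \<tau>) = 1 * h z" if "z \<notin> period_lattice \<tau>" for z
      using that by (simp add: h_def phi_add_tau phi_mult_tau_def weierstrass_p_add_tau[OF tau] power_mult_distrib)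
  qed auto
  have "C = - weierstrass_p \<tau> (omega \<tau> $ \<alpha>)"
    using C[OF omega_notin_lattice[of \<alpha>]] by (simp add: h_def phi_omega)
  thus ?thesis using C[OF assms] by (simp add: h_def algebra_simps)
qed

text \<open>The poles -1/z^2 and 1/z^2 cancel in h, and both summands have the multipliers of
  \<open>phi\<close> for \<alpha>, the product because two characters multiply to the third. Thus h
  is constant, and since one of its multipliers is -1 the constant is 0.\<close>

lemma deriv_phi:
  assumes dist: "\<alpha> \<noteq> \<beta>" "\<beta> \<noteq> \<gamma>" "\<alpha> \<noteq> \<gamma>" and z: "z \<notin> period_lattice \<tau>"
  shows "deriv (phi \<tau> \<alpha>) z = - (phi \<tau> \<beta> z * phi \<tau> \<gamma> z)"
proof -
  define h where "h = (\<lambda>z. deriv (phi \<tau> \<alpha>) z + phi \<tau> \<beta> z * phi \<tau> \<gamma> z)"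
  obtain r g where g: "r > 0" "g holomorphic_on ball 0 r" "g 0 = 0"
    "\<forall>z\<in>ball 0 r - {0}. phi \<tau> \<alpha> z = 1 / z + g z"
    using phi_expansion[of \<alpha>] by blast
  have lim_g: "(deriv g \<longlongrightarrow> deriv g 0) (at 0)"
  proof -
    have "deriv g holomorphic_on ball 0 r" using g(2) by (intro holomorphic_deriv) auto
    hence "isCont (deriv g) 0"
      using holomorphic_on_imp_continuous_on[of "deriv g" "ball 0 r"] g(1)
      by (simp add: continuous_on_eq_continuous_at)
    thus ?thesis by (simp add: isCont_def)
  qed
  have expansion: "\<exists>k d. ((\<lambda>z. k z / z) \<longlongrightarrow> d) (at 0) \<and> (k \<longlongrightarrow> 0) (at 0) \<and>
      (\<forall>\<^sub>F z in at 0. phi \<tau> \<epsilon> z = 1 / z + k z)" for \<epsilon>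
  proof -
    obtain s k where k: "s > 0" "k holomorphic_on ball 0 s" "k 0 = 0"
      "\<forall>z\<in>ball 0 s - {0}. phi \<tau> \<epsilon> z = 1 / z + k z"
      using phi_expansion[of \<epsilon>] by blast
    have der: "(k has_field_derivative deriv k 0) (at 0)"
      using k by (intro holomorphic_derivI[of k "ball 0 s"]) auto
    have "((\<lambda>z. k z / z) \<longlongrightarrow> deriv k 0) (at 0)" using der k(3) by (simp add: DERIV_def)
    moreover have "(k \<longlongrightarrow> 0) (at 0)" using DERIV_isCont[OF der] k(3) by (simp add: isCont_def)
    moreover have "\<forall>\<^sub>F z in at 0. z \<in> ball 0 s - {0}"
      using k(1) by (intro eventually_at_in_open) auto
    hence "\<forall>\<^sub>F z in at 0. phi \<tau> \<epsilon> z = 1 / z + k z" by eventually_elim (simp add: k(4))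
    ultimately show ?thesis by blast
  qed
  obtain b b' where b: "((\<lambda>z. b z / z) \<longlongrightarrow> b') (at 0)" "(b \<longlongrightarrow> 0) (at 0)"
      "\<forall>\<^sub>F z in at 0. phi \<tau> \<beta> z = 1 / z + b z" using expansion by blast
  obtain c c' where c: "((\<lambda>z. c z / z) \<longlongrightarrow> c') (at 0)" "(c \<longlongrightarrow> 0) (at 0)"
      "\<forall>\<^sub>F z in at 0. phi \<tau> \<gamma> z = 1 / z + c z" using expansion by blast
  have "((\<lambda>z. deriv g z + (b z / z + c z / z + b z * c z)) \<longlongrightarrow> deriv g 0 + (b' + c' + 0 * 0)) (at 0)"
    by (intro tendsto_intros lim_g b c)
  moreover have "\<forall>\<^sub>F z in at 0. deriv g z + (b z / z + c z / z + b z * c z) = h z"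
  proof -
    have "\<forall>\<^sub>F z in at 0. z \<in> ball 0 r - {0}"
      using g(1) by (intro eventually_at_in_open) auto
    with b(3) c(3) show ?thesis
    proof eventually_elim
      case (elim z)
      have "((\<lambda>z. 1 / z + g z) has_field_derivative - 1 / z\<^sup>2 + deriv g z) (at z)"
        using elim g(2)
        by (auto intro!: derivative_eq_intros holomorphic_derivI[of g "ball 0 r"] simp: power2_eq_square)
      hence "(phi \<tau> \<alpha> has_field_derivative - 1 / z\<^sup>2 + deriv g z) (at z)"
        using elim g(4)
        by (elim has_field_derivative_transform_within_open[where S = "ball 0 r - {0}"]) auto
      hence "deriv (phi \<tau> \<alpha>) z = - 1 / z\<^sup>2 + deriv g z" by (rule DERIV_imp_deriv)
      hence "h z = - 1 / z\<^sup>2 + deriv g z + (1 / z + b z) * (1 / z + c z)"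
        by (simp only: h_def elim)
      also have "\<dots> = deriv g z + (b z / z + c z / z + b z * c z)"
        by (simp add: ring_distribs add_divide_distrib power2_eq_square)
      finally show ?case by (rule sym)
    qed
  qed
  ultimately have lim: "(h \<longlongrightarrow> deriv g 0 + (b' + c' + 0 * 0)) (at 0)"
    by (rule Lim_transform_eventually)
  have deriv_shift: "deriv (phi \<tau> \<alpha>) (z + w) = e * deriv (phi \<tau> \<alpha>) z"
    if "w \<in> period_lattice \<tau>" "\<And>z. phi \<tau> \<alpha> (z + w) = e * phi \<tau> \<alpha> z" "z \<notin> period_lattice \<tau>" for z w e
  proof -
    have "z + w \<notin> period_lattice \<tau>" using that by (simp add: period_lattice_add_iff)
    hence "((\<lambda>z. phi \<tau> \<alpha> (z + w)) has_field_derivative deriv (phi \<tau> \<alpha>) (z + w)) (at z)"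
      using DERIV_shift phi_has_field_derivative by blast
    moreover have "((\<lambda>z. phi \<tau> \<alpha> (z + w)) has_field_derivative e * deriv (phi \<tau> \<alpha>) z) (at z)"
      unfolding that(2) by (intro DERIV_cmult phi_has_field_derivative that(3))
    ultimately show ?thesis by (rule DERIV_unique)
  qed
  have h1: "h (z + 1) = phi_mult_1 \<alpha> * h z" if "z \<notin> period_lattice \<tau>" for z
    using deriv_shift[OF _ phi_add_1 that]
    unfolding h_def phi_add_1 phi_mult_third(1)[OF dist, symmetric] by (simp add: algebra_simps)
  have ht: "h (z + \<tau>) = phi_mult_tau \<alpha> * h z" if "z \<notin> period_lattice \<tau>" for z
    using deriv_shift[OF _ phi_add_tau that]
    unfolding h_def phi_add_tau phi_mult_third(2)[OF dist, symmetric] by (simp add: algebra_simps)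
  obtain C where C: "\<And>z. z \<notin> period_lattice \<tau> \<Longrightarrow> h z = C"
  proof (rule elliptic_constant[OF tau _ h1 ht _ _ lim])
    show "h holomorphic_on - period_lattice \<tau>"
      unfolding h_def by (intro holomorphic_intros phi_holomorphic open_Compl_lattice[OF tau])
  qed (auto simp: phi_mult_1_def phi_mult_tau_def)
  define u where "u = omega \<tau> $ 1"
  have u: "u \<notin> period_lattice \<tau>" unfolding u_def by (rule omega_notin_lattice)
  have "C = phi_mult_1 \<alpha> * C"
    using h1[OF u] C[OF u] C[of "u + 1"] u by (simp add: period_lattice_add_iff)
  moreover have "C = phi_mult_tau \<alpha> * C"
    using ht[OF u] C[OF u] C[of "u + \<tau>"] u by (simp add: period_lattice_add_iff)
  ultimately have "C = 0"
    by (auto simp: phi_mult_1_def phi_mult_tau_def split: if_splits)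
  thus ?thesis using C[OF z] by (simp add: h_def eq_neg_iff_add_eq_0)
qed

text \<open>Differentiating \<open>theta_half_shift\<close> at 0 relates the derivatives of
  \<open>theta\<close> at \<omega>_\<alpha> and at -\<omega>_\<alpha>. They are equal because
  \<open>theta\<close> is odd, so the relation can be solved for the logarithmic derivative.\<close>

lemma E1_omega: "E1 \<tau> (omega \<tau> $ \<alpha>) = - (2 * pi * \<i> * d_omega \<tau> $ \<alpha>)"
proof -
  let ?w = "omega \<tau> $ \<alpha>" and ?d = "d_omega \<tau> $ \<alpha>" and ?D = "deriv (theta \<tau>)"
  have even: "?D (- ?w) = ?D ?w"
  proof -
    have "((\<lambda>z. theta \<tau> (- z)) has_field_derivative ?D (- ?w) * (- 1)) (at ?w)"
      by (rule DERIV_chain2[OF theta_has_field_derivative[OF tau]]) (auto intro!: derivative_eq_intros)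
    moreover have "((\<lambda>z. theta \<tau> (- z)) has_field_derivative - ?D ?w) (at ?w)"
      unfolding theta_minus by (intro DERIV_minus theta_has_field_derivative[OF tau])
    ultimately have "?D (- ?w) * (- 1) = - ?D ?w" by (rule DERIV_unique)
    thus ?thesis by simp
  qed
  have "((\<lambda>z. theta \<tau> (z + ?w)) has_field_derivative ?D ?w) (at 0)"
    using theta_has_field_derivative[OF tau, of "0 + ?w"] by (subst DERIV_shift[symmetric]) simp
  moreover have "((\<lambda>z. theta \<tau> (z + ?w)) has_field_derivative
      4 * pi * \<i> * ?d * theta \<tau> (- ?w) - ?D (- ?w)) (at 0)"
  proof -
    have "((\<lambda>z. theta \<tau> (z - ?w)) has_field_derivative ?D (- ?w)) (at 0)"
      using theta_has_field_derivative[OF tau, of "0 + - ?w"] DERIV_shift[of "theta \<tau>" _ 0 "- ?w"] by simp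
    thus ?thesis unfolding theta_half_shift
      by (auto intro!: derivative_eq_intros)
  qed
  ultimately have "?D ?w = 4 * pi * \<i> * ?d * theta \<tau> (- ?w) - ?D (- ?w)" by (rule DERIV_unique)
  hence sum: "?D ?w + ?D ?w = 4 * pi * \<i> * ?d * - theta \<tau> ?w"
    unfolding eq_diff_eq even theta_minus .
  have "?D ?w = (?D ?w + ?D ?w) / 2" by simp
  also have "\<dots> = - (2 * pi * \<i> * ?d) * theta \<tau> ?w" unfolding sum by simp
  finally have "?D ?w = - (2 * pi * \<i> * ?d) * theta \<tau> ?w" .
  thus ?thesis using theta_omega[of \<alpha>] by (simp add: E1_def)
qed

lemma DERIV_exp_quotient:
  fixes f g :: "complex \<Rightarrow> complex"
  assumes f: "(f has_field_derivative F) (at z)" and g: "(g has_field_derivative G) (at z)"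
    and nz: "f z \<noteq> 0" "g z \<noteq> 0"
  shows "((\<lambda>z. exp (a * z) * (f z / g z)) has_field_derivative
    exp (a * z) * (f z / g z) * (a + F / f z - G / g z)) (at z)"
proof -
  have "((\<lambda>z. exp (a * z) * (f z / g z)) has_field_derivative
      exp (a * z) * a * (f z / g z) + exp (a * z) * ((F * g z - f z * G) / (g z * g z))) (at z)"
    using nz(2) by (auto intro!: derivative_eq_intros f g simp: field_simps)
  also have "exp (a * z) * a * (f z / g z) + exp (a * z) * ((F * g z - f z * G) / (g z * g z)) =
      exp (a * z) * (f z / g z) * (a + F / f z - G / g z)"
    using nz by (simp add: field_simps)
  finally show ?thesis .
qed

text \<open>The logarithmic derivative of \<open>phi\<close> is 2 pi i \<partial>\<omega>_\<alpha> +
  E1 (z + \<omega>_\<alpha>) - E1 z, and \<open>E1_omega\<close> identifies the first summand as -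
  E1 \<omega>_\<alpha>. This brings the derivative of \<open>phi\<close> into M.\<close>

lemma phi_E1:
  assumes z: "z \<in> spectral_domain \<tau>"
  shows "phi \<tau> \<alpha> z * (E1 \<tau> (z + omega \<tau> $ \<alpha>) - E1 \<tau> (omega \<tau> $ \<alpha>)) =
    deriv (phi \<tau> \<alpha>) z + phi \<tau> \<alpha> z * E1 \<tau> z"
proof -
  let ?w = "omega \<tau> $ \<alpha>" and ?d = "d_omega \<tau> $ \<alpha>" and ?D = "deriv (theta \<tau>)"
  have nz: "theta \<tau> z \<noteq> 0" "theta \<tau> (z + ?w) \<noteq> 0" "theta \<tau> ?w \<noteq> 0"
    using spectral_domain_notin[OF z] theta_nz theta_omega by auto
  have 1: "((\<lambda>z. theta \<tau> (z + ?w)) has_field_derivative ?D (z + ?w)) (at z)"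
    using theta_has_field_derivative[OF tau, of "z + ?w"] by (subst DERIV_shift[symmetric])
  have 2: "(theta \<tau> has_field_derivative ?D z) (at z)" by (rule theta_has_field_derivative[OF tau])
  let ?K = "deriv (theta \<tau>) 0 / theta \<tau> ?w"
  have phi_fun: "phi \<tau> \<alpha> = (\<lambda>z. ?K * (exp ((2 * pi * \<i> * ?d) * z) * (theta \<tau> (z + ?w) / theta \<tau> z)))"
    by (simp add: fun_eq_iff phi_eq mult_ac)
  have "(phi \<tau> \<alpha> has_field_derivative ?K * (exp ((2 * pi * \<i> * ?d) * z) * (theta \<tau> (z + ?w) / theta \<tau> z) *
      (2 * pi * \<i> * ?d + ?D (z + ?w) / theta \<tau> (z + ?w) - ?D z / theta \<tau> z))) (at z)"
    unfolding phi_fun by (intro DERIV_cmult DERIV_exp_quotient 1 2 nz)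
  hence "(phi \<tau> \<alpha> has_field_derivative
      phi \<tau> \<alpha> z * (2 * pi * \<i> * ?d + E1 \<tau> (z + ?w) - E1 \<tau> z)) (at z)"
    unfolding phi_fun E1_def by (simp only: mult.assoc)
  hence "deriv (phi \<tau> \<alpha>) z = phi \<tau> \<alpha> z * (2 * pi * \<i> * ?d + E1 \<tau> (z + ?w) - E1 \<tau> z)"
    by (rule DERIV_imp_deriv)
  thus ?thesis by (simp add: E1_omega algebra_simps)
qed

text \<open>In the product of \<open>phi\<close> at z - \<omega>_\<alpha> and at z the value of
  \<open>theta\<close> at z cancels, and the quotient of its values at z + \<omega>_\<alpha> and z -
  \<omega>_\<alpha> is an exponential that the prefactors reduce to a constant. The definition of
  \<nu>' is \<nu> times this constant.\<close>

lemma phi_shift_omega: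
  assumes z: "z \<in> spectral_domain \<tau>"
  shows "\<nu> $ \<alpha> * phi \<tau> \<alpha> (z - omega \<tau> $ \<alpha>) = nu' \<tau> \<nu> $ \<alpha> / phi \<tau> \<alpha> z"
proof -
  let ?w = "omega \<tau> $ \<alpha>" and ?d = "d_omega \<tau> $ \<alpha>" and ?D = "deriv (theta \<tau>) 0"
  let ?s = "theta \<tau> (z - ?w)"
  have nz: "theta \<tau> z \<noteq> 0" "?s \<noteq> 0" "theta \<tau> ?w \<noteq> 0"
    using spectral_domain_notin[OF z] theta_nz theta_omega by auto
  have "phi \<tau> \<alpha> (z - ?w) * phi \<tau> \<alpha> z =
      - (exp (2 * pi * \<i> * (z - ?w) * ?d) * exp (2 * pi * \<i> * z * ?d) * exp (- 4 * pi * \<i> * ?d * z)) *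
      (?D / theta \<tau> ?w)\<^sup>2"
    using nz by (simp add: phi_eq theta_half_shift power2_eq_square)
  also have "exp (2 * pi * \<i> * (z - ?w) * ?d) * exp (2 * pi * \<i> * z * ?d) * exp (- 4 * pi * \<i> * ?d * z) =
      exp (- 2 * pi * \<i> * ?w * ?d)"
    unfolding exp_add[symmetric] by (rule arg_cong[of _ _ exp]) (simp add: algebra_simps)
  finally have "\<nu> $ \<alpha> * phi \<tau> \<alpha> (z - ?w) * phi \<tau> \<alpha> z = nu' \<tau> \<nu> $ \<alpha>"
    by (simp add: nu'_def mult.assoc)
  thus ?thesis using phi_nonzero[OF z] by (simp add: field_simps)
qed

end

subsection \<open>Pauli matrices and the Lax equation\<close>

definition pauli_sum :: "(3 \<Rightarrow> complex) \<Rightarrow> complex^2^2" where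
  "pauli_sum x = (\<Sum>\<alpha>\<in>UNIV. x \<alpha> *\<^sub>m pauli $ \<alpha>)"

lemma pauli_sum_entries:
  "pauli_sum x $ 1 $ 1 = x 3" "pauli_sum x $ 1 $ 2 = x 1 - \<i> * x 2"
  "pauli_sum x $ 2 $ 1 = x 1 + \<i> * x 2" "pauli_sum x $ 2 $ 2 = - x 3"
  by (simp_all add: pauli_sum_def mat_scale_def pauli_def sum_3 vector_def)

lemma commutator_pauli_sum:
  "commutator (pauli_sum x) (pauli_sum y) = pauli_sum (\<lambda>\<alpha>. 2 * \<i> * ((\<chi> \<beta>. x \<beta>) \<times>\<^sub>c (\<chi> \<beta>. y \<beta>)) $ \<alpha>)"
  by (simp add: vec_eq_iff forall_2 commutator_def matrix_matrix_mult_def sum_2 pauli_sum_entries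
      ccross_def vector_3 algebra_simps)

text \<open>By linear independence of the Pauli matrices the coefficients are fixed linear
  combinations of the entries, so existence of the derivatives passes in both directions as
  well.\<close>

lemma has_field_derivative_pauli_sum:
  "(\<forall>i j. ((\<lambda>t. pauli_sum (x t) $ i $ j) has_field_derivative pauli_sum c $ i $ j) (at t within T)) \<longleftrightarrow>
   (\<forall>\<alpha>. ((\<lambda>t. x t \<alpha>) has_field_derivative c \<alpha>) (at t within T))"
proof
  assume L: "\<forall>i j. ((\<lambda>t. pauli_sum (x t) $ i $ j) has_field_derivative pauli_sum c $ i $ j) (at t within T)"
  have 12: "((\<lambda>t. x t 1 - \<i> * x t 2) has_field_derivative c 1 - \<i> * c 2) (at t within T)"
    using L[rule_format, of 1 2] by (simp add: pauli_sum_entries)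
  have 21: "((\<lambda>t. x t 1 + \<i> * x t 2) has_field_derivative c 1 + \<i> * c 2) (at t within T)"
    using L[rule_format, of 2 1] by (simp add: pauli_sum_entries)
  have "((\<lambda>t. x t 1) has_field_derivative c 1) (at t within T)"
    using DERIV_cmult[OF DERIV_add[OF 12 21], of "1/2"] by simp
  moreover have "((\<lambda>t. x t 2) has_field_derivative c 2) (at t within T)"
    using DERIV_cmult[OF DERIV_diff[OF 12 21], of "\<i>/2"] by (simp add: algebra_simps)
  moreover have "((\<lambda>t. x t 3) has_field_derivative c 3) (at t within T)"
    using L[rule_format, of 1 1] by (simp add: pauli_sum_entries)
  ultimately show "\<forall>\<alpha>. ((\<lambda>t. x t \<alpha>) has_field_derivative c \<alpha>) (at t within T)" by (simp add: forall_3)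
next
  assume "\<forall>\<alpha>. ((\<lambda>t. x t \<alpha>) has_field_derivative c \<alpha>) (at t within T)"
  thus "\<forall>i j. ((\<lambda>t. pauli_sum (x t) $ i $ j) has_field_derivative pauli_sum c $ i $ j) (at t within T)"
    by (auto simp: forall_2 pauli_sum_entries intro!: derivative_eq_intros)
qed

text \<open>The chain rule for r = c t and for its inverse. Since T is arbitrary, the derivatives
  have to be taken within T and within its image.\<close>

lemma has_field_derivative_rescale_iff:
  fixes c :: complex
  assumes "c \<noteq> 0"
  shows "((\<lambda>r. f (r / c)) has_field_derivative D / c) (at (c * t) within (\<lambda>t. c * t) ` T) \<longleftrightarrow>
    (f has_field_derivative D) (at t within T)"
proof
  assume "(f has_field_derivative D) (at t within T)"
  moreover have "(\<lambda>r. r / c) ` (\<lambda>t. c * t) ` T = T" using assms by (force simp: image_image)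
  moreover have "((\<lambda>r. r / c) has_field_derivative 1 / c) (at (c * t) within (\<lambda>t. c * t) ` T)"
    using assms by (auto intro!: derivative_eq_intros)
  ultimately have "(f \<circ> (\<lambda>r. r / c) has_field_derivative D * (1 / c)) (at (c * t) within (\<lambda>t. c * t) ` T)"
    using assms by (intro DERIV_image_chain) auto
  thus "((\<lambda>r. f (r / c)) has_field_derivative D / c) (at (c * t) within (\<lambda>t. c * t) ` T)"
    by (simp add: o_def)
next
  assume *: "((\<lambda>r. f (r / c)) has_field_derivative D / c) (at (c * t) within (\<lambda>t. c * t) ` T)"
  have "((\<lambda>t. c * t) has_field_derivative c) (at t within T)"
    by (auto intro!: derivative_eq_intros)
  from DERIV_image_chain[OF * this] show "(f has_field_derivative D) (at t within T)"
    using assms by (simp add: o_def)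
qed

text \<open>Under S -> -S the quadratic term is unchanged and the linear term flips, which repairs
  the relative sign. The left side flips too, so the factor -2 i becomes 2 i, and the new time
  absorbs it.\<close>

lemma solves_ode_rescale:
  "solves_ode ((\<lambda>t. 2 * \<i> * t) ` T) (\<lambda>s. s \<times>\<^sub>c J_op \<tau> s + s \<times>\<^sub>c n) (\<lambda>r. - S (r / (2 * \<i>))) \<longleftrightarrow>
   solves_ode T (\<lambda>s. (- 2 * \<i>) *s (s \<times>\<^sub>c J_op \<tau> s - s \<times>\<^sub>c n)) S"
proof -
  have rhs: "((- s) \<times>\<^sub>c J_op \<tau> (- s) + (- s) \<times>\<^sub>c n) $ \<alpha> =
      - (((- 2 * \<i>) *s (s \<times>\<^sub>c J_op \<tau> s - s \<times>\<^sub>c n)) $ \<alpha>) / (2 * \<i>)" for s \<alpha>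
    using exhaust_3[of \<alpha>] by (auto simp: ccross_def J_op_def vector_3 field_simps)
  have "((\<lambda>r. (- S (r / (2 * \<i>))) $ \<alpha>) has_field_derivative
        ((- S (2 * \<i> * t / (2 * \<i>))) \<times>\<^sub>c J_op \<tau> (- S (2 * \<i> * t / (2 * \<i>))) + (- S (2 * \<i> * t / (2 * \<i>))) \<times>\<^sub>c n) $ \<alpha>)
        (at (2 * \<i> * t) within (\<lambda>t. 2 * \<i> * t) ` T) \<longleftrightarrow>
      ((\<lambda>t. S t $ \<alpha>) has_field_derivative ((- 2 * \<i>) *s (S t \<times>\<^sub>c J_op \<tau> (S t) - S t \<times>\<^sub>c n)) $ \<alpha>)
        (at t within T)" for t \<alpha>
  proof -
    have t: "2 * \<i> * t / (2 * \<i>) = t" by simp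
    have minus: "((\<lambda>t. - f t) has_field_derivative - D) (at t within T) \<longleftrightarrow>
        (f has_field_derivative D) (at t within T)" for f D
      by (auto dest: DERIV_minus)
    show ?thesis
      unfolding t rhs
      using has_field_derivative_rescale_iff[of "2 * \<i>" "\<lambda>t. - (S t $ \<alpha>)"
          "- (((- 2 * \<i>) *s (S t \<times>\<^sub>c J_op \<tau> (S t) - S t \<times>\<^sub>c n)) $ \<alpha>)" t T]
      by (simp only: vector_uminus_component minus) simp
  qed
  thus ?thesis unfolding solves_ode_def by (simp only: ball_simps)
qed

lemma pauli_sum_cong: "(\<And>\<alpha>. x \<alpha> = y \<alpha>) \<Longrightarrow> pauli_sum x = pauli_sum y"
  by presburger

lemma pauli_sum_add: "pauli_sum x + pauli_sum y = pauli_sum (\<lambda>\<alpha>. x \<alpha> + y \<alpha>)"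
  and pauli_sum_minus: "- pauli_sum x = pauli_sum (\<lambda>\<alpha>. - x \<alpha>)"
  and mat_scale_pauli_sum: "c *\<^sub>m pauli_sum x = pauli_sum (\<lambda>\<alpha>. c * x \<alpha>)"
  by (simp_all add: vec_eq_iff forall_2 pauli_sum_entries mat_scale_def algebra_simps)

definition M_ZVG :: "complex \<Rightarrow> complex^3 \<Rightarrow> complex^3 \<Rightarrow> complex \<Rightarrow> complex^2^2" where
  "M_ZVG \<tau> \<nu> s z = pauli_sum (\<lambda>\<alpha>.
     s $ \<alpha> * phi \<tau> \<alpha> z * (E1 \<tau> (z + omega \<tau> $ \<alpha>) - E1 \<tau> (omega \<tau> $ \<alpha>))
       + \<nu> $ \<alpha> * phi \<tau> \<alpha> (z - omega \<tau> $ \<alpha>) * E1 \<tau> z)"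

section \<open>The commutator and the equivalence of the two equations\<close>

context
  fixes \<tau> :: complex
  assumes tau: "Im \<tau> > 0"
begin

lemma L_ZVG_eq:
  assumes z: "z \<in> spectral_domain \<tau>"
  shows "L_ZVG \<tau> \<nu> s z = pauli_sum (\<lambda>\<alpha>. s $ \<alpha> * phi \<tau> \<alpha> z + nu' \<tau> \<nu> $ \<alpha> / phi \<tau> \<alpha> z)"
  unfolding L_ZVG_def pauli_sum_def[symmetric]
  by (intro pauli_sum_cong) (simp add: phi_shift_omega[OF tau z])

lemma deriv_phi_quotient:
  assumes z: "z \<in> spectral_domain \<tau>"
  shows "deriv (phi \<tau> \<alpha>) z = - (phi \<tau> 1 z * phi \<tau> 2 z * phi \<tau> 3 z / phi \<tau> \<alpha> z)"
proof -
  note nz = phi_nonzero[OF tau z] and d = deriv_phi[OF tau _ _ _ spectral_domain_notin(1)[OF z]]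
  consider "\<alpha> = 1" | "\<alpha> = 2" | "\<alpha> = 3" using exhaust_3 by blast
  thus ?thesis
  proof cases
    case 1 thus ?thesis using d[of 1 2 3] nz[of 1] by simp
  next
    case 2 thus ?thesis using d[of 2 1 3] nz[of 2] by simp
  next
    case 3 thus ?thesis using d[of 3 1 2] nz[of 3] by simp
  qed
qed

lemma M_ZVG_eq:
  assumes z: "z \<in> spectral_domain \<tau>"
  shows "M_ZVG \<tau> \<nu> s z =
    - pauli_sum (\<lambda>\<alpha>. s $ \<alpha> * (phi \<tau> 1 z * phi \<tau> 2 z * phi \<tau> 3 z / phi \<tau> \<alpha> z))
    + E1 \<tau> z *\<^sub>m L_ZVG \<tau> \<nu> s z"
  unfolding M_ZVG_def L_ZVG_def pauli_sum_def[symmetric] pauli_sum_minus mat_scale_pauli_sum pauli_sum_add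
proof (rule pauli_sum_cong)
  fix \<alpha>
  show "s $ \<alpha> * phi \<tau> \<alpha> z * (E1 \<tau> (z + omega \<tau> $ \<alpha>) - E1 \<tau> (omega \<tau> $ \<alpha>))
       + \<nu> $ \<alpha> * phi \<tau> \<alpha> (z - omega \<tau> $ \<alpha>) * E1 \<tau> z =
    - (s $ \<alpha> * (phi \<tau> 1 z * phi \<tau> 2 z * phi \<tau> 3 z / phi \<tau> \<alpha> z)) +
      E1 \<tau> z * (s $ \<alpha> * phi \<tau> \<alpha> z + \<nu> $ \<alpha> * phi \<tau> \<alpha> (z - omega \<tau> $ \<alpha>))"
    unfolding mult.assoc phi_E1[OF tau z] deriv_phi_quotient[OF z]
    by (simp add: algebra_simps)
qed

lemma commutator_ZVG:
  assumes z: "z \<in> spectral_domain \<tau>"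
  shows "commutator (L_ZVG \<tau> \<nu> s z) (M_ZVG \<tau> \<nu> s z) =
    pauli_sum (\<lambda>\<alpha>. phi \<tau> \<alpha> z * ((- 2 * \<i>) *s (s \<times>\<^sub>c J_op \<tau> s - s \<times>\<^sub>c nu' \<tau> \<nu>)) $ \<alpha>)"
proof -
  define f where "f = (\<lambda>\<alpha>. phi \<tau> \<alpha> z)"
  define n where "n = nu' \<tau> \<nu>"
  define w where "w = (\<lambda>\<alpha>. weierstrass_p \<tau> (omega \<tau> $ \<alpha>))"
  define x where "x = (\<lambda>\<alpha>. s $ \<alpha> * f \<alpha> + n $ \<alpha> / f \<alpha>)"
  define y where "y = (\<lambda>\<alpha>. - (s $ \<alpha> * (f 1 * f 2 * f 3 / f \<alpha>)))"
  have L: "L_ZVG \<tau> \<nu> s z = pauli_sum x"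
    by (simp add: L_ZVG_eq[OF z] x_def f_def n_def)
  have M: "M_ZVG \<tau> \<nu> s z = pauli_sum (\<lambda>\<alpha>. y \<alpha> + E1 \<tau> z * x \<alpha>)"
    unfolding M_ZVG_eq[OF z] L pauli_sum_minus mat_scale_pauli_sum pauli_sum_add y_def f_def ..
  have sq: "f \<alpha> * f \<alpha> = weierstrass_p \<tau> z - w \<alpha>" for \<alpha>
    using phi_square[OF tau spectral_domain_notin(1)[OF z]] by (simp add: f_def w_def power2_eq_square)
  have nz: "f \<alpha> \<noteq> 0" for \<alpha> unfolding f_def by (rule phi_nonzero[OF tau z])
  have y: "y 1 = - s $ 1 * (f 2 * f 3)" "y 2 = - s $ 2 * (f 1 * f 3)" "y 3 = - s $ 3 * (f 1 * f 2)"
    using nz by (simp_all add: y_def)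
  \<comment> \<open>One component of the cross product: r is the value of \<open>phi\<close> at its
    own index, p and q are those at the other two. The factor p (or q) in y cancels the denominator
    in x, so r splits off and \<open>phi\<close> enters otherwise only through p^2 - q^2.\<close>
  have key: "(a * p + u / p) * (- b * (r * p)) - (b * q + v / q) * (- a * (r * q)) =
      - r * (a * b * (p * p - q * q) - (a * v - b * u))"
    if "p \<noteq> 0" "q \<noteq> 0" for a b p q r u v :: complex
    using that by (simp add: field_simps)
  have "x 2 * y 3 - x 3 * y 2 = - f 1 * (s $ 2 * s $ 3 * (w 3 - w 2) - (s $ 2 * n $ 3 - s $ 3 * n $ 2))"
    using key[OF nz[of 2] nz[of 3], of "s $ 2" "n $ 2" "s $ 3" "f 1" "n $ 3"]
    by (simp add: sq y x_def)
  moreover have "x 3 * y 1 - x 1 * y 3 = - f 2 * (s $ 3 * s $ 1 * (w 1 - w 3) - (s $ 3 * n $ 1 - s $ 1 * n $ 3))"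
    using key[OF nz[of 3] nz[of 1], of "s $ 3" "n $ 3" "s $ 1" "f 2" "n $ 1"]
    by (simp add: sq y x_def mult.commute)
  moreover have "x 1 * y 2 - x 2 * y 1 = - f 3 * (s $ 1 * s $ 2 * (w 2 - w 1) - (s $ 1 * n $ 2 - s $ 2 * n $ 1))"
    using key[OF nz[of 1] nz[of 2], of "s $ 1" "n $ 1" "s $ 2" "f 3" "n $ 2"]
    by (simp add: sq y x_def mult.commute)
  ultimately have cross: "((\<chi> \<beta>. x \<beta>) \<times>\<^sub>c (\<chi> \<beta>. y \<beta> + E1 \<tau> z * x \<beta>)) $ \<alpha> =
      - f \<alpha> * (s \<times>\<^sub>c J_op \<tau> s - s \<times>\<^sub>c n) $ \<alpha>" for \<alpha>
    using exhaust_3[of \<alpha>] by (auto simp: ccross_def J_op_def w_def vector_3 algebra_simps)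
  show ?thesis unfolding L M commutator_pauli_sum cross
    by (simp add: f_def n_def algebra_simps)
qed

lemma lax_equation_iff:
  "lax_equation T (spectral_domain \<tau>) (\<lambda>t. L_ZVG \<tau> \<nu> (S t)) (\<lambda>t. M_ZVG \<tau> \<nu> (S t)) \<longleftrightarrow>
   solves_ode T (\<lambda>s. (- 2 * \<i>) *s (s \<times>\<^sub>c J_op \<tau> s - s \<times>\<^sub>c nu' \<tau> \<nu>)) S"
proof -
  let ?F = "\<lambda>s. (- 2 * \<i>) *s (s \<times>\<^sub>c J_op \<tau> s - s \<times>\<^sub>c nu' \<tau> \<nu>)"
  have pointwise: "(\<forall>i j. ((\<lambda>t. L_ZVG \<tau> \<nu> (S t) z $ i $ j) has_field_derivative
        commutator (L_ZVG \<tau> \<nu> (S t) z) (M_ZVG \<tau> \<nu> (S t) z) $ i $ j) (at t within T)) \<longleftrightarrow>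
      (\<forall>\<alpha>. ((\<lambda>t. S t $ \<alpha>) has_field_derivative ?F (S t) $ \<alpha>) (at t within T))"
    if z: "z \<in> spectral_domain \<tau>" for z t
  proof -
    have entry: "((\<lambda>t. S t $ \<alpha> * phi \<tau> \<alpha> z + c) has_field_derivative phi \<tau> \<alpha> z * D) (at t within T) \<longleftrightarrow>
        ((\<lambda>t. S t $ \<alpha>) has_field_derivative D) (at t within T)" for \<alpha> c D
    proof
      assume "((\<lambda>t. S t $ \<alpha> * phi \<tau> \<alpha> z + c) has_field_derivative phi \<tau> \<alpha> z * D) (at t within T)"
      from DERIV_cmult[OF DERIV_diff[OF this DERIV_const[of c]], of "1 / phi \<tau> \<alpha> z"]
      show "((\<lambda>t. S t $ \<alpha>) has_field_derivative D) (at t within T)"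
        using phi_nonzero[OF tau z] by simp
    qed (auto intro!: derivative_eq_intros)
    show ?thesis
      unfolding commutator_ZVG[OF z]
      unfolding L_ZVG_eq[OF z] has_field_derivative_pauli_sum entry ..
  qed
  \<comment> \<open>By \<open>pointwise\<close> a single z already gives the differential equation
    for S, so a witness in the domain is all that the forward direction asks for; 2 * (1/4) = 1/2 is
    a half-period off the lattice.\<close>
  have "(1 :: complex) / 4 \<in> spectral_domain \<tau>"
    using half_lattice_iff[OF tau, of 1 0] by (simp add: spectral_domain_def)
  thus ?thesis unfolding lax_equation_def solves_ode_def using pointwise by blast
qed

end

theorem proposition5p4:
  fixes \<tau> :: complex and \<nu> :: "complex^3"
  assumes "Im \<tau> > 0"
  shows
    "(\<forall>s. \<forall>z\<in>spectral_domain \<tau>.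
        L_ZVG \<tau> \<nu> s z =
          (\<Sum>\<alpha>\<in>UNIV. (s $ \<alpha> * phi \<tau> \<alpha> z + nu' \<tau> \<nu> $ \<alpha> / phi \<tau> \<alpha> z) *\<^sub>m pauli $ \<alpha>)) \<and>
     (\<exists>M :: complex^3 \<Rightarrow> complex \<Rightarrow> complex^2^2.
        (\<forall>s. \<forall>z\<in>spectral_domain \<tau>.
           M s z = (\<Sum>\<alpha>\<in>UNIV.
             (s $ \<alpha> * phi \<tau> \<alpha> z * (E1 \<tau> (z + omega \<tau> $ \<alpha>) - E1 \<tau> (omega \<tau> $ \<alpha>))
               + \<nu> $ \<alpha> * phi \<tau> \<alpha> (z - omega \<tau> $ \<alpha>) * E1 \<tau> z) *\<^sub>m pauli $ \<alpha>) \<and>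
           M s z =
             - (\<Sum>\<alpha>\<in>UNIV. (s $ \<alpha> * (phi \<tau> 1 z * phi \<tau> 2 z * phi \<tau> 3 z / phi \<tau> \<alpha> z)) *\<^sub>m pauli $ \<alpha>)
             + E1 \<tau> z *\<^sub>m L_ZVG \<tau> \<nu> s z) \<and>
        (\<forall>T S.
           (lax_equation T (spectral_domain \<tau>) (\<lambda>t. L_ZVG \<tau> \<nu> (S t)) (\<lambda>t. M (S t)) \<longleftrightarrow>
            solves_ode T (\<lambda>s. (- 2 * \<i>) *s (s \<times>\<^sub>c J_op \<tau> s - s \<times>\<^sub>c nu' \<tau> \<nu>)) S) \<and>
           (lax_equation T (spectral_domain \<tau>) (\<lambda>t. L_ZVG \<tau> \<nu> (S t)) (\<lambda>t. M (S t)) \<longleftrightarrow>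
            solves_ode ((\<lambda>t. 2 * \<i> * t) ` T)
              (\<lambda>s. s \<times>\<^sub>c J_op \<tau> s + s \<times>\<^sub>c nu' \<tau> \<nu>)
              (\<lambda>r. - S (r / (2 * \<i>))))))"
proof (intro conjI allI ballI exI[of _ "M_ZVG \<tau> \<nu>"])
  fix s z assume z: "z \<in> spectral_domain \<tau>"
  show "L_ZVG \<tau> \<nu> s z =
      (\<Sum>\<alpha>\<in>UNIV. (s $ \<alpha> * phi \<tau> \<alpha> z + nu' \<tau> \<nu> $ \<alpha> / phi \<tau> \<alpha> z) *\<^sub>m pauli $ \<alpha>)"
    using L_ZVG_eq[OF assms z] by (simp only: pauli_sum_def)
  show "M_ZVG \<tau> \<nu> s z = (\<Sum>\<alpha>\<in>UNIV.
      (s $ \<alpha> * phi \<tau> \<alpha> z * (E1 \<tau> (z + omega \<tau> $ \<alpha>) - E1 \<tau> (omega \<tau> $ \<alpha>))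
        + \<nu> $ \<alpha> * phi \<tau> \<alpha> (z - omega \<tau> $ \<alpha>) * E1 \<tau> z) *\<^sub>m pauli $ \<alpha>)"
    by (simp only: M_ZVG_def pauli_sum_def)
  show "M_ZVG \<tau> \<nu> s z =
      - (\<Sum>\<alpha>\<in>UNIV. (s $ \<alpha> * (phi \<tau> 1 z * phi \<tau> 2 z * phi \<tau> 3 z / phi \<tau> \<alpha> z)) *\<^sub>m pauli $ \<alpha>)
      + E1 \<tau> z *\<^sub>m L_ZVG \<tau> \<nu> s z"
    using M_ZVG_eq[OF assms z] by (simp only: pauli_sum_def)
qed (simp_all only: lax_equation_iff[OF assms] solves_ode_rescale)

end
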